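(* Let $\mathcal{Q}$ be a set of laws on $\mathcal{X}^{\mathbb{N}}$ locally dominated by a reference measure $\mathtt{R}$, and let $\widetilde{\mathcal{Q}}$ be its closed fork-convex hull. Let $(E_t)_{t\ge0}$ be a $\mathcal{Q}$-safe e-process. Then $(E_t)$ is dominated by (or equals) some $\mathcal{Q}$-NSM $(L_t)$ with $L_0\le1$ if and only if $(E_t)$ is $\widetilde{\mathcal{Q}}$-safe (and therefore powerless against $\widetilde{\mathcal{Q}}\setminus\mathcal{Q}$, i.e. $\mathtt{P}(\inf\{t\ge1:E_t\ge1/\alpha\}<\infty)\le\alpha$ for every $\mathtt{P}\in\widetilde{\mathcal{Q}}\setminus\mathcal{Q}$ and $\alpha\in(0,1)$).
   Context: $\mathcal{X}$ is a measurable space; $(X_t)_{t\ge1}$ are the coordinates on $\mathcal{X}^{\mathbb{N}}$, $\mathcal{F}_0$ is trivial, $\mathcal{F}_t=\sigma(X_1,\dots,X_t)$. In this statement a $\mathcal{Q}$-NSM is a nonnegative process adapted to $(\mathcal{F}_t)$ that is a supermartingale under every $\mathtt{Q}\in\mathcal{Q}$ (no normalization of the initial value beyond what is stated). $(E_t)$ is dominated by $(L_t)$ if $E_t\le L_t$ for all $t$, $\mathtt{Q}$-almost surely for every $\mathtt{Q}\in\mathcal{Q}$. For a set $\mathcal{P}$ of laws, a nonnegative adapted process $(E_t)_{t\ge0}$ is a $\mathcal{P}$-safe e-process (is $\mathcal{P}$-safe) if $\sup_{\mathtt{P}\in\mathcal{P}}\sup_\tau\mathbb{E}_{\mathtt{P}}[E_\tau]\le1$,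 where $\tau$ ranges over all, possibly infinite, stopping times and $E_\infty:=\limsup_{t\to\infty}E_t$. A law $\mathtt{P}$ is locally dominated by a probability measure $\mathtt{R}$ if $\mathtt{P}|_{\mathcal{F}_t}\ll\mathtt{R}|_{\mathcal{F}_t}$ for all $t\in\mathbb{N}$; its likelihood ratio process is $Z_t=\mathrm{d}\mathtt{P}|_{\mathcal{F}_t}/\mathrm{d}\mathtt{R}|_{\mathcal{F}_t}$. A set of laws is locally dominated by $\mathtt{R}$ if each of its elements is. A fork-convex combination of two locally dominated laws $\mathtt{Q},\mathtt{Q}'$ with likelihood ratio processes $(Z_t),(Z'_t)$ is a law $\mathtt{Q}''$ with likelihood ratio process $$Z''_t=\begin{cases}Z_t,&t\le s,\\ hZ_t+(1-h)Z_s\dfrac{Z'_t}{Z'_s},&t>s,\end{cases}$$ for some $s\in\{0,1,2,\dots\}$ and some $\mathcal{F}_s$-measurable random variable $h$ with values in $[0,1]$ and $h=1$ on $\{Z'_s=0\}$ (with the convention $0/0:=1$). A set of (locally dominated) laws is fork-convex if it contains every fork-convex combination of its elements. The fork-convex hull of a set is the intersection of all fork-convex sets containing it. The closed fork-convex hull is the closure of the fork-convex hull with respect to $L^1(\mathtt{R})$ convergence of the likelihood ratio processes at each fixed time $t\in\mathbb{N}$. *)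

theory Defs
  imports "HOL-Probability.Probability"
begin

section \<open>Sequence space, coordinate filtration, laws\<close>

definition seq_space :: "'a measure \<Rightarrow> (nat \<Rightarrow> 'a) measure" where
  "seq_space M = Pi\<^sub>M {1..} (\<lambda>_. M)"

text \<open>The coordinates are \<open>X\<^sub>i \<omega> = \<omega> i\<close> for \<open>i \<ge> 1\<close>. For \<open>t = 0\<close> the generator is empty,
  so \<open>F\<^sub>0\<close> is the trivial \<open>\<sigma>\<close>-algebra.\<close>

definition coord_filt :: "'a measure \<Rightarrow> nat \<Rightarrow> (nat \<Rightarrow> 'a) measure" where
  "coord_filt M t = sigma (space (seq_space M))
     (\<Union>i\<in>{1..t}. {(\<lambda>\<omega>. \<omega> i) -` A \<inter> space (seq_space M) | A. A \<in> sets M})"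

definition law :: "'a measure \<Rightarrow> (nat \<Rightarrow> 'a) measure \<Rightarrow> bool" where
  "law M P \<longleftrightarrow> prob_space P \<and> sets P = sets (seq_space M)"

section \<open>Processes, supermartingales, safe e-processes\<close>

definition nonneg_adapted :: "'a measure \<Rightarrow> (nat \<Rightarrow> (nat \<Rightarrow> 'a) \<Rightarrow> real) \<Rightarrow> bool" where
  "nonneg_adapted M E \<longleftrightarrow>
     (\<forall>t. E t \<in> borel_measurable (coord_filt M t) \<and> (\<forall>\<omega>\<in>space (seq_space M). 0 \<le> E t \<omega>))"

definition supermartingale ::
    "'a measure \<Rightarrow> (nat \<Rightarrow> 'a) measure \<Rightarrow> (nat \<Rightarrow> (nat \<Rightarrow> 'a) \<Rightarrow> real) \<Rightarrow> bool" where
  "supermartingale M Q L \<longleftrightarrow>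
     (\<forall>t. L t \<in> borel_measurable (coord_filt M t) \<and> integrable Q (L t)) \<and>
     (\<forall>s t. s \<le> t \<longrightarrow> (AE \<omega> in Q. real_cond_exp Q (coord_filt M s) (L t) \<omega> \<le> L s \<omega>))"

definition NSM ::
    "'a measure \<Rightarrow> (nat \<Rightarrow> 'a) measure set \<Rightarrow> (nat \<Rightarrow> (nat \<Rightarrow> 'a) \<Rightarrow> real) \<Rightarrow> bool" where
  "NSM M \<Q> L \<longleftrightarrow> nonneg_adapted M L \<and> (\<forall>Q\<in>\<Q>. supermartingale M Q L)"

definition dominated_by ::
    "(nat \<Rightarrow> 'a) measure set \<Rightarrow> (nat \<Rightarrow> (nat \<Rightarrow> 'a) \<Rightarrow> real) \<Rightarrow>
     (nat \<Rightarrow> (nat \<Rightarrow> 'a) \<Rightarrow> real) \<Rightarrow> bool" where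
  "dominated_by \<Q> E L \<longleftrightarrow> (\<forall>t. \<forall>Q\<in>\<Q>. AE \<omega> in Q. E t \<omega> \<le> L t \<omega>)"

text \<open>Stopping times may be infinite; the condition at \<open>\<infinity>\<close> imposes no restriction.\<close>

definition seq_stopping_time :: "'a measure \<Rightarrow> ((nat \<Rightarrow> 'a) \<Rightarrow> enat) \<Rightarrow> bool" where
  "seq_stopping_time M \<tau> \<longleftrightarrow>
     stopping_time (\<lambda>t. case t of enat n \<Rightarrow> coord_filt M n | \<infinity> \<Rightarrow> seq_space M) \<tau>"

text \<open>\<open>E\<^sub>\<infinity> = limsup E\<^sub>t\<close> may be infinite, hence the stopped value is extended-real valued.\<close>

definition stopped ::
    "(nat \<Rightarrow> (nat \<Rightarrow> 'a) \<Rightarrow> real) \<Rightarrow> ((nat \<Rightarrow> 'a) \<Rightarrow> enat) \<Rightarrow> (nat \<Rightarrow> 'a) \<Rightarrow> ennreal" where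
  "stopped E \<tau> \<omega> =
     (case \<tau> \<omega> of enat t \<Rightarrow> ennreal (E t \<omega>) | \<infinity> \<Rightarrow> limsup (\<lambda>t. ennreal (E t \<omega>)))"

definition safe ::
    "'a measure \<Rightarrow> (nat \<Rightarrow> 'a) measure set \<Rightarrow> (nat \<Rightarrow> (nat \<Rightarrow> 'a) \<Rightarrow> real) \<Rightarrow> bool" where
  "safe M \<P> E \<longleftrightarrow> nonneg_adapted M E \<and>
     (SUP P\<in>\<P>. SUP \<tau>\<in>{\<tau>. seq_stopping_time M \<tau>}. \<integral>\<^sup>+\<omega>. stopped E \<tau> \<omega> \<partial>P) \<le> 1"

definition first_exceed ::
    "(nat \<Rightarrow> (nat \<Rightarrow> 'a) \<Rightarrow> real) \<Rightarrow> real \<Rightarrow> (nat \<Rightarrow> 'a) \<Rightarrow> enat" where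
  "first_exceed E c \<omega> = (INF t\<in>{t::nat. 1 \<le> t \<and> c \<le> E t \<omega>}. enat t)"

definition powerless ::
    "(nat \<Rightarrow> 'a) measure set \<Rightarrow> (nat \<Rightarrow> (nat \<Rightarrow> 'a) \<Rightarrow> real) \<Rightarrow> bool" where
  "powerless \<P> E \<longleftrightarrow> (\<forall>P\<in>\<P>. \<forall>\<alpha>\<in>{0<..<1}.
     measure P {\<omega>\<in>space P. first_exceed E (1 / \<alpha>) \<omega> < \<infinity>} \<le> \<alpha>)"

section \<open>Local domination and fork-convexity\<close>

definition locally_dominated ::
    "'a measure \<Rightarrow> (nat \<Rightarrow> 'a) measure \<Rightarrow> (nat \<Rightarrow> 'a) measure \<Rightarrow> bool" where
  "locally_dominated M R P \<longleftrightarrow> (\<forall>t. absolutely_continuous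
     (restr_to_subalg R (coord_filt M t)) (restr_to_subalg P (coord_filt M t)))"

text \<open>One fixed version of the density process; every statement about it below holds up to
  \<open>R\<close>-null sets, so the choice of version is immaterial.\<close>

definition likelihood_ratio ::
    "'a measure \<Rightarrow> (nat \<Rightarrow> 'a) measure \<Rightarrow> (nat \<Rightarrow> 'a) measure \<Rightarrow> nat \<Rightarrow> (nat \<Rightarrow> 'a) \<Rightarrow> real" where
  "likelihood_ratio M R P t \<omega> = enn2real (RN_deriv
     (restr_to_subalg R (coord_filt M t)) (restr_to_subalg P (coord_filt M t)) \<omega>)"

text \<open>Division with the convention \<open>0 / 0 = 1\<close>.\<close>

definition fork_ratio :: "real \<Rightarrow> real \<Rightarrow> real" where
  "fork_ratio a b = (if a = 0 \<and> b = 0 then 1 else a / b)"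

definition fork_combination ::
    "'a measure \<Rightarrow> (nat \<Rightarrow> 'a) measure \<Rightarrow> (nat \<Rightarrow> 'a) measure \<Rightarrow> (nat \<Rightarrow> 'a) measure \<Rightarrow>
     (nat \<Rightarrow> 'a) measure \<Rightarrow> bool" where
  "fork_combination M R Q Q' Q'' \<longleftrightarrow>
     law M Q'' \<and> locally_dominated M R Q'' \<and>
     (\<exists>s h. h \<in> borel_measurable (coord_filt M s) \<and>
        (\<forall>\<omega>\<in>space (seq_space M). 0 \<le> h \<omega> \<and> h \<omega> \<le> 1) \<and>
        (AE \<omega> in R. likelihood_ratio M R Q' s \<omega> = 0 \<longrightarrow> h \<omega> = 1) \<and>
        (\<forall>t. AE \<omega> in R. likelihood_ratio M R Q'' t \<omega> =
           (if t \<le> s then likelihood_ratio M R Q t \<omega>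
            else h \<omega> * likelihood_ratio M R Q t \<omega> +
              (1 - h \<omega>) * likelihood_ratio M R Q s \<omega> *
                fork_ratio (likelihood_ratio M R Q' t \<omega>) (likelihood_ratio M R Q' s \<omega>))))"

definition fork_convex ::
    "'a measure \<Rightarrow> (nat \<Rightarrow> 'a) measure \<Rightarrow> (nat \<Rightarrow> 'a) measure set \<Rightarrow> bool" where
  "fork_convex M R \<S> \<longleftrightarrow> (\<forall>P\<in>\<S>. law M P \<and> locally_dominated M R P) \<and>
     (\<forall>Q\<in>\<S>. \<forall>Q'\<in>\<S>. \<forall>Q''. fork_combination M R Q Q' Q'' \<longrightarrow> Q'' \<in> \<S>)"

definition fork_hull ::
    "'a measure \<Rightarrow> (nat \<Rightarrow> 'a) measure \<Rightarrow> (nat \<Rightarrow> 'a) measure set \<Rightarrow> (nat \<Rightarrow> 'a) measure set" where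
  "fork_hull M R \<Q> = \<Inter>{\<S>. fork_convex M R \<S> \<and> \<Q> \<subseteq> \<S>}"

text \<open>\<open>L\<^sup>1(R)\<close> convergence at each of countably many times is a pseudometrizable topology on
  locally dominated laws, so closure is sequential closure.\<close>

definition closed_fork_hull ::
    "'a measure \<Rightarrow> (nat \<Rightarrow> 'a) measure \<Rightarrow> (nat \<Rightarrow> 'a) measure set \<Rightarrow> (nat \<Rightarrow> 'a) measure set" where
  "closed_fork_hull M R \<Q> = {P. law M P \<and> locally_dominated M R P \<and>
     (\<exists>Pn. (\<forall>n::nat. Pn n \<in> fork_hull M R \<Q>) \<and>
        (\<forall>t. (\<lambda>n. \<integral>\<^sup>+\<omega>. ennreal \<bar>likelihood_ratio M R (Pn n) t \<omega> - likelihood_ratio M R P t \<omega>\<bar> \<partial>R)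
              \<longlonglongrightarrow> 0))}"

end

theory Submission
  imports Defs
begin

text \<open>If \<open>L\<close> is a \<open>\<Q>\<close>-NSM dominating \<open>E\<close>, then the laws under which \<open>L\<close> is a supermartingale and
  \<open>E \<le> L\<close> form a fork-convex set that is closed under \<open>L\<^sup>1\<close> convergence of the likelihood ratios,
  so it contains the closed fork-convex hull, and optional stopping gives safety.
  Conversely, if \<open>E\<close> is safe on the hull, let \<open>L\<^sub>t\<close> be the essential supremum, under \<open>R\<close>, of the
  conditional expectations of \<open>E\<^sub>\<tau>\<close> given \<open>F\<^sub>t\<close>, over all stopping times \<open>\<tau> \<ge> t\<close> and all laws in the
  hull. Fork-convexity allows one to switch at time \<open>t\<close> from a law in \<open>\<Q>\<close> to nearly optimal
  laws and stopping times, so \<open>L\<close> is a supermartingale under every law in \<open>\<Q>\<close>.\<close>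

section \<open>The coordinate filtration\<close>

text \<open>Everything rests on the linear form of a fork: for s \<le> t, an F_t-measurable f has
  expectation E_Q[h f] + E_Q'[k f] under the combination, with F_s-measurable weights h and k. The
  weight k contains Z_s / Z'_s and is unbounded, so the supermartingale inequality is tested against
  all nonnegative F_s-measurable functions, not only indicators; the weights then disappear into the
  test function. This form also allows infinite values, and integrability is settled at the end.
  Laws in the hull need not be equivalent, and a conditional expectation under Q' is determined only
  where Z'_t > 0. The essential supremum counts it as 0 elsewhere; switching only where the new
  value is strictly larger then yields h = 1 on {Z'_t = 0}, exactly what a fork demands. The
  supremum ranges over the hull because each switch may leave \<Q>. It need not be attained, so
  finite maxima are realised by repeated switching and monotone convergence does the rest.\<close>

lemma space_coord_filt [simp]: "space (coord_filt M t) = space (seq_space M)"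
  by (simp add: coord_filt_def space_measure_of_conv)

lemma sets_coord_filt:
  "sets (coord_filt M t) = sigma_sets (space (seq_space M))
     (\<Union>i\<in>{1..t}. {(\<lambda>\<omega>. \<omega> i) -` A \<inter> space (seq_space M) | A. A \<in> sets M})"
  unfolding coord_filt_def by (rule sets_measure_of) auto

lemma sets_coord_filt_mono: "s \<le> t \<Longrightarrow> sets (coord_filt M s) \<subseteq> sets (coord_filt M t)"
  unfolding sets_coord_filt by (rule sigma_sets_mono') (fastforce simp: subset_eq)

lemma sets_coord_filt_subset: "sets (coord_filt M t) \<subseteq> sets (seq_space M)"
proof -
  have "(\<lambda>\<omega>. \<omega> i) -` A \<inter> space (seq_space M) \<in> sets (seq_space M)"
    if "i \<in> {1..t}" "A \<in> sets M" for i A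
    unfolding seq_space_def using that by (intro measurable_sets[OF measurable_component_singleton]) auto
  then show ?thesis
    unfolding sets_coord_filt by (intro sets.sigma_sets_subset) auto
qed

lemma measurable_coord_filt_mono:
  "s \<le> t \<Longrightarrow> f \<in> measurable (coord_filt M s) N \<Longrightarrow> f \<in> measurable (coord_filt M t) N"
  using sets_coord_filt_mono[of s t M] by (auto simp: measurable_def)

lemma measurable_coord_filt_law:
  "law M P \<Longrightarrow> f \<in> measurable (coord_filt M t) N \<Longrightarrow> f \<in> measurable P N"
  using sets_coord_filt_subset[of M t] sets_eq_imp_space_eq[of P "seq_space M"]
  by (auto simp: measurable_def law_def)

lemma space_law: "law M P \<Longrightarrow> space P = space (seq_space M)"
  by (auto simp: law_def dest: sets_eq_imp_space_eq)

lemma sets_coord_filt_law: "law M P \<Longrightarrow> A \<in> sets (coord_filt M t) \<Longrightarrow> A \<in> sets P"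
  using sets_coord_filt_subset[of M t] by (auto simp: law_def)

lemma subalgebra_law: "law M P \<Longrightarrow> subalgebra P (coord_filt M t)"
  using sets_coord_filt_subset[of M t] by (auto simp: subalgebra_def space_law law_def)

lemma sigma_finite_subalgebra_law: "law M P \<Longrightarrow> sigma_finite_subalgebra P (coord_filt M t)"
  by (intro finite_measure_subalgebra_is_sigma_finite)
     (auto simp: finite_measure_subalgebra_def finite_measure_subalgebra_axioms_def
       subalgebra_law law_def prob_space.finite_measure)

text \<open>Prepares the approximation of arbitrary events by events of finite time: the induction
  in \<open>law_measure_approx\<close> runs over this generator.\<close>

lemma sets_seq_space:
  "sets (seq_space M) = sigma_sets (space (seq_space M)) (\<Union>t. sets (coord_filt M t))"
proof
  show "sigma_sets (space (seq_space M)) (\<Union>t. sets (coord_filt M t)) \<subseteq> sets (seq_space M)"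
    using sets_coord_filt_subset by (intro sets.sigma_sets_subset) blast
  have "{f \<in> space (seq_space M). f i \<in> A} \<in> sets (coord_filt M i)"
    if "i \<in> {1..}" "A \<in> sets M" for i A
    unfolding sets_coord_filt using that
    by (intro sigma_sets.Basic) (auto simp: vimage_def intro!: bexI[of _ i])
  then show "sets (seq_space M) \<subseteq> sigma_sets (space (seq_space M)) (\<Union>t. sets (coord_filt M t))"
    unfolding seq_space_def sets_PiM_single space_PiM
    by (intro sigma_sets_mono') auto
qed

text \<open>The only events of F_0 are the empty set and the whole space, and the preimage of a
  point must be one of them. This turns a bound in expectation at time 0 into a bound at every
  point.\<close>

lemma coord_filt_0_const:
  assumes "f \<in> borel_measurable (coord_filt M 0)" "\<omega> \<in> space (seq_space M)" "\<omega>' \<in> space (seq_space M)"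
  shows "f \<omega> = (f \<omega>' :: 'b :: t1_space)"
proof -
  have "f -` {f \<omega>'} \<inter> space (coord_filt M 0) \<in> sets (coord_filt M 0)"
    using assms(1) by (rule measurable_sets) simp
  then have "f -` {f \<omega>'} \<inter> space (seq_space M) \<in> {{}, space (seq_space M)}"
    by (simp add: sets_coord_filt sigma_sets_empty_eq)
  with assms(2,3) show ?thesis by auto
qed

section \<open>Nonnegative supermartingales in integral form\<close>

text \<open>Both sides have the same integrals over every set of the subalgebra, which characterises
  \<open>nn_cond_exp\<close>. This links the definition of a supermartingale to integrals of
  nonnegative functions.\<close>

lemma (in sigma_finite_subalgebra) ennreal_real_cond_exp:
  assumes [measurable]: "integrable M f" and nn: "AE x in M. 0 \<le> f x"
  shows "AE x in M. ennreal (real_cond_exp M F f x) = nn_cond_exp M F (\<lambda>x. ennreal (f x)) x"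
proof (rule nn_cond_exp_charact)
  fix A assume A [measurable]: "A \<in> sets F"
  have [measurable]: "A \<in> sets M"
    using A subalg by (auto simp: subalgebra_def)
  have pos: "AE x in M. 0 \<le> real_cond_exp M F f x"
    using nn by (intro real_cond_exp_pos) auto
  have int: "integrable M (real_cond_exp M F f)"
    using assms(1) by (rule real_cond_exp_int)
  have "(\<integral>\<^sup>+x\<in>A. ennreal (f x) \<partial>M) = (\<integral>\<^sup>+x. ennreal (indicator A x * f x) \<partial>M)"
    by (intro nn_integral_cong) (auto simp: indicator_def)
  also have "\<dots> = ennreal (\<integral>x. indicator A x * f x \<partial>M)"
    using nn assms(1)
    by (intro nn_integral_eq_integral integrable_mult_indicator[where 'b=real, simplified]) auto
  also have "(\<integral>x. indicator A x * f x \<partial>M) = (\<integral>x. indicator A x * real_cond_exp M F f x \<partial>M)"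
    using real_cond_exp_intA[OF assms(1) A] by (simp add: set_lebesgue_integral_def)
  also have "ennreal \<dots> = (\<integral>\<^sup>+x. ennreal (indicator A x * real_cond_exp M F f x) \<partial>M)"
    using pos int
    by (intro nn_integral_eq_integral[symmetric] integrable_mult_indicator[where 'b=real, simplified]) auto
  also have "\<dots> = (\<integral>\<^sup>+x\<in>A. ennreal (real_cond_exp M F f x) \<partial>M)"
    by (intro nn_integral_cong) (auto simp: indicator_def)
  finally show "(\<integral>\<^sup>+x\<in>A. ennreal (f x) \<partial>M) = (\<integral>\<^sup>+x\<in>A. ennreal (real_cond_exp M F f x) \<partial>M)" .
qed auto

text \<open>Test with the event where the inequality fails: there the conditional expectation
  exceeds u pointwise but not in the integral, so the event is null. Finiteness of the integral of u
  makes the subtraction legitimate.\<close>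

lemma (in sigma_finite_subalgebra) nn_cond_exp_leI:
  assumes [measurable]: "f \<in> borel_measurable M" and u [measurable]: "u \<in> borel_measurable F"
    and fin: "(\<integral>\<^sup>+x. u x \<partial>M) < \<infinity>"
    and le: "\<And>A. A \<in> sets F \<Longrightarrow> (\<integral>\<^sup>+x. indicator A x * f x \<partial>M) \<le> (\<integral>\<^sup>+x. indicator A x * u x \<partial>M)"
  shows "AE x in M. nn_cond_exp M F f x \<le> u x"
proof -
  let ?c = "nn_cond_exp M F f"
  define A where "A = {x\<in>space F. u x < ?c x}"
  have A [measurable]: "A \<in> sets F" unfolding A_def by measurable
  have [measurable]: "A \<in> sets M" "u \<in> borel_measurable M"
    using A subalg measurable_from_subalg[OF subalg u] by (auto simp: subalgebra_def)
  have "(\<integral>\<^sup>+x. indicator A x * u x \<partial>M) \<le> (\<integral>\<^sup>+x. u x \<partial>M)"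
    by (intro nn_integral_mono) (auto simp: indicator_def)
  with fin have fin': "(\<integral>\<^sup>+x. indicator A x * u x \<partial>M) \<noteq> \<infinity>"
    by (auto simp: top_unique)
  have "(\<integral>\<^sup>+x. indicator A x * ?c x - indicator A x * u x \<partial>M)
      = (\<integral>\<^sup>+x. indicator A x * ?c x \<partial>M) - (\<integral>\<^sup>+x. indicator A x * u x \<partial>M)"
    using fin' by (intro nn_integral_diff) (auto, auto simp: indicator_def A_def)
  also have "(\<integral>\<^sup>+x. indicator A x * ?c x \<partial>M) = (\<integral>\<^sup>+x. indicator A x * f x \<partial>M)"
    by (rule nn_cond_exp_intg) auto
  finally have "(\<integral>\<^sup>+x. indicator A x * ?c x - indicator A x * u x \<partial>M) = 0"
    using le[OF A] fin' by (simp add: diff_eq_0_iff_ennreal less_top[symmetric] top_unique) (metis neq_top_trans)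
  then have "AE x in M. indicator A x * ?c x - indicator A x * u x = 0"
    by (subst (asm) nn_integral_0_iff_AE) auto
  then show ?thesis
  proof (rule AE_mp, intro AE_I2 impI)
    fix x assume x: "x \<in> space M" "indicator A x * ?c x - indicator A x * u x = 0"
    have *: "u x < top" if "x \<in> A"
      using that by (auto simp: A_def less_top[symmetric])
    show "?c x \<le> u x"
    proof (rule ccontr)
      assume "\<not> ?c x \<le> u x"
      then have "x \<in> A" using x(1) subalg by (auto simp: A_def subalgebra_def)
      with x(2) * \<open>\<not> ?c x \<le> u x\<close> show False
        by (auto simp: diff_eq_0_iff_ennreal)
    qed
  qed
qed

text \<open>The supermartingale inequality in weak form, free of conditional expectations and of
  integrability. It is stable under multiplication of the law by an F_s-measurable density at times
  after s, which is what a fork does.\<close>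

definition nn_supermartingale ::
    "'a measure \<Rightarrow> (nat \<Rightarrow> 'a) measure \<Rightarrow> (nat \<Rightarrow> (nat \<Rightarrow> 'a) \<Rightarrow> ennreal) \<Rightarrow> bool" where
  "nn_supermartingale M P L \<longleftrightarrow> (\<forall>s t g. s \<le> t \<longrightarrow> g \<in> borel_measurable (coord_filt M s) \<longrightarrow>
     (\<integral>\<^sup>+\<omega>. g \<omega> * L t \<omega> \<partial>P) \<le> (\<integral>\<^sup>+\<omega>. g \<omega> * L s \<omega> \<partial>P))"

lemma nn_supermartingaleD:
  "nn_supermartingale M P L \<Longrightarrow> s \<le> t \<Longrightarrow> g \<in> borel_measurable (coord_filt M s) \<Longrightarrow>
     (\<integral>\<^sup>+\<omega>. g \<omega> * L t \<omega> \<partial>P) \<le> (\<integral>\<^sup>+\<omega>. g \<omega> * L s \<omega> \<partial>P)"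
  by (auto simp: nn_supermartingale_def)

lemma nn_supermartingale_SucI:
  assumes "\<And>t g. g \<in> borel_measurable (coord_filt M t) \<Longrightarrow>
     (\<integral>\<^sup>+\<omega>. g \<omega> * L (Suc t) \<omega> \<partial>P) \<le> (\<integral>\<^sup>+\<omega>. g \<omega> * L t \<omega> \<partial>P)"
  shows "nn_supermartingale M P L"
  unfolding nn_supermartingale_def
proof (intro allI impI)
  fix s t :: nat and g :: "(nat \<Rightarrow> 'a) \<Rightarrow> ennreal"
  assume "s \<le> t" "g \<in> borel_measurable (coord_filt M s)"
  then show "(\<integral>\<^sup>+\<omega>. g \<omega> * L t \<omega> \<partial>P) \<le> (\<integral>\<^sup>+\<omega>. g \<omega> * L s \<omega> \<partial>P)"
    by (induction t rule: dec_induct)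
       (auto intro: order_trans[OF assms] measurable_coord_filt_mono)
qed

lemma nn_supermartingale_supermartingale:
  assumes law: "law M P" and sm: "supermartingale M P L" and ad: "nonneg_adapted M L"
  shows "nn_supermartingale M P (\<lambda>t \<omega>. ennreal (L t \<omega>))"
  unfolding nn_supermartingale_def
proof (intro allI impI)
  fix s t :: nat and g :: "(nat \<Rightarrow> 'a) \<Rightarrow> ennreal"
  assume "s \<le> t" and g: "g \<in> borel_measurable (coord_filt M s)"
  interpret sigma_finite_subalgebra P "coord_filt M s"
    by (rule sigma_finite_subalgebra_law[OF law])
  have int: "integrable P (L t)" and nn: "AE x in P. 0 \<le> L t x"
    using sm ad by (auto simp: supermartingale_def nonneg_adapted_def space_law[OF law])
  have [measurable]: "L t \<in> borel_measurable P" using int by auto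
  have ae: "AE x in P. real_cond_exp P (coord_filt M s) (L t) x \<le> L s x"
    using sm \<open>s \<le> t\<close> by (auto simp: supermartingale_def)
  have "(\<integral>\<^sup>+\<omega>. g \<omega> * ennreal (L t \<omega>) \<partial>P)
      = (\<integral>\<^sup>+\<omega>. g \<omega> * nn_cond_exp P (coord_filt M s) (\<lambda>x. ennreal (L t x)) \<omega> \<partial>P)"
    by (rule nn_cond_exp_intg[symmetric]) (use g in auto)
  also have "\<dots> \<le> (\<integral>\<^sup>+\<omega>. g \<omega> * ennreal (L s \<omega>) \<partial>P)"
  proof (rule nn_integral_mono_AE)
    show "AE x in P. g x * nn_cond_exp P (coord_filt M s) (\<lambda>x. ennreal (L t x)) x \<le> g x * ennreal (L s x)"
      using ennreal_real_cond_exp[OF int nn] ae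
      by eventually_elim (metis ennreal_leI mult_left_mono zero_le)
  qed
  finally show "(\<integral>\<^sup>+\<omega>. g \<omega> * ennreal (L t \<omega>) \<partial>P) \<le> (\<integral>\<^sup>+\<omega>. g \<omega> * ennreal (L s \<omega>) \<partial>P)" .
qed

text \<open>Finiteness at time 0 spreads to all later times through the test function 1; after that,
  \<open>nn_cond_exp_leI\<close> recovers the conditional inequality.\<close>

lemma supermartingale_nn_supermartingale:
  assumes law: "law M P" and ad: "nonneg_adapted M L"
    and sm: "nn_supermartingale M P (\<lambda>t \<omega>. ennreal (L t \<omega>))"
    and fin: "(\<integral>\<^sup>+\<omega>. ennreal (L 0 \<omega>) \<partial>P) < \<infinity>"
  shows "supermartingale M P L"
proof -
  have [measurable]: "L t \<in> borel_measurable (coord_filt M t)" for t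
    using ad by (auto simp: nonneg_adapted_def)
  have L [measurable]: "L t \<in> borel_measurable P" for t
    by (rule measurable_coord_filt_law[OF law, of _ t]) simp
  have nn: "AE x in P. 0 \<le> L t x" for t
    using ad by (auto simp: nonneg_adapted_def space_law[OF law])
  have fin': "(\<integral>\<^sup>+\<omega>. ennreal (L t \<omega>) \<partial>P) < \<infinity>" for t
    using nn_supermartingaleD[OF sm, of 0 t "\<lambda>_. 1"] fin by (auto simp: le_less_trans)
  have int: "integrable P (L t)" for t
    using nn fin' by (intro integrableI_nonneg) auto
  have "AE x in P. real_cond_exp P (coord_filt M s) (L t) x \<le> L s x" if "s \<le> t" for s t
  proof -
    interpret sigma_finite_subalgebra P "coord_filt M s"
      by (rule sigma_finite_subalgebra_law[OF law])
    have "AE x in P. nn_cond_exp P (coord_filt M s) (\<lambda>x. ennreal (L t x)) x \<le> ennreal (L s x)"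
      by (rule nn_cond_exp_leI) (use fin' nn_supermartingaleD[OF sm that] in auto)
    then show ?thesis using ennreal_real_cond_exp[OF int[of t] nn[of t]] nn[of s]
    proof eventually_elim
      case (elim x)
      then have "ennreal (real_cond_exp P (coord_filt M s) (L t) x) \<le> ennreal (L s x)" by simp
      with elim(3) show ?case by (simp only: ennreal_le_iff)
    qed
  qed
  with int show ?thesis by (auto simp: supermartingale_def)
qed

section \<open>Optional stopping at possibly infinite times\<close>

text \<open>Induction over the generated sigma-algebra: symmetric differences are invariant under
  complement, and a countable union is close to a finite one, whose members are approximated
  separately and share a common time.\<close>

lemma law_measure_approx:
  assumes law: "law M P" and B: "B \<in> sets P" and e: "0 < (e::real)"
  shows "\<exists>n. \<exists>A\<in>sets (coord_filt M n). emeasure P ((A - B) \<union> (B - A)) \<le> ennreal e"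
proof -
  interpret prob_space P using law by (simp add: law_def)
  note meas = sets_coord_filt_law[OF law]
  have "B \<in> sigma_sets (space (seq_space M)) (\<Union>t. sets (coord_filt M t))"
    using B law by (simp add: law_def sets_seq_space)
  then show ?thesis using e
  proof (induction arbitrary: e)
    case (Basic B)
    then obtain n where "B \<in> sets (coord_filt M n)" by auto
    then show ?case by (intro exI[of _ n] bexI[of _ B]) auto
  next
    case Empty
    show ?case by (intro exI[of _ 0] bexI[of _ "{}"]) auto
  next
    case (Compl B)
    then obtain n A where A: "A \<in> sets (coord_filt M n)"
      "emeasure P ((A - B) \<union> (B - A)) \<le> ennreal e" by blast
    have "B \<subseteq> space (seq_space M)"
      using Compl.hyps sets.sets_into_space[of B P] law
      by (simp add: law_def space_law[OF law] flip: sets_seq_space)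
    moreover have "A \<subseteq> space (seq_space M)"
      using sets.sets_into_space[OF A(1)] by simp
    ultimately have "((space (seq_space M) - A) - (space (seq_space M) - B))
      \<union> ((space (seq_space M) - B) - (space (seq_space M) - A)) = (A - B) \<union> (B - A)"
      by auto
    moreover have "space (seq_space M) - A \<in> sets (coord_filt M n)"
      using sets.compl_sets[OF A(1)] by simp
    ultimately show ?case using A(2) by (intro exI[of _ n] bexI[of _ "space (seq_space M) - A"]) auto
  next
    case (Union B)
    have [measurable]: "B i \<in> sets P" for i
      using Union.hyps law by (simp add: law_def flip: sets_seq_space)
    have "(\<lambda>i. measure P (\<Union>j<i. B j)) \<longlonglongrightarrow> measure P (\<Union>i. \<Union>j<i. B j)"
      by (rule finite_Lim_measure_incseq) (auto simp: incseq_def intro: less_le_trans)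
    moreover have "(\<Union>i. \<Union>j<i. B j) = (\<Union>i. B i)" by auto
    ultimately have "\<forall>\<^sub>F i in sequentially. measure P (\<Union>i. B i) - e / 2 < measure P (\<Union>j<i. B j)"
      using Union.prems by (intro order_tendstoD(1)) auto
    then obtain m where m: "measure P (\<Union>i. B i) - e / 2 < measure P (\<Union>j<m. B j)"
      by (auto simp: eventually_sequentially)
    \<comment> \<open>m errors of size d add up to at most e / 2; the added 1 keeps the quotient
      meaningful for m = 0. The other e / 2 pays for cutting the union at m.\<close>
    define d where "d = e / (2 * (real m + 1))"
    have "0 < d" using Union.prems by (simp add: d_def)
    then have "\<forall>j. \<exists>n A. A \<in> sets (coord_filt M n) \<and> emeasure P ((A - B j) \<union> (B j - A)) \<le> ennreal d"
      using Union.IH by blast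
    then obtain n A where A: "\<And>j. A j \<in> sets (coord_filt M (n j))"
      "\<And>j. emeasure P ((A j - B j) \<union> (B j - A j)) \<le> ennreal d" by metis
    \<comment> \<open>The sum serves as a common upper bound of the finitely many times
      \<open>n j\<close>.\<close>
    define N where "N = (\<Sum>j<m. n j)"
    have AN: "A j \<in> sets (coord_filt M N)" if "j < m" for j
      using A(1)[of j] sets_coord_filt_mono[of "n j" N M] that
      by (auto simp: N_def intro: member_le_sum)
    have [measurable]: "A j \<in> sets P" for j using meas[OF A(1)] .
    have "emeasure P (\<Union>j<m. (A j - B j) \<union> (B j - A j))
        \<le> (\<Sum>j<m. emeasure P ((A j - B j) \<union> (B j - A j)))"
      by (intro emeasure_subadditive_finite) auto
    also have "\<dots> \<le> (\<Sum>j<m. ennreal d)" using A(2) by (intro sum_mono) auto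
    also have "\<dots> = ennreal (real m * d)"
      using \<open>0 < d\<close> by (simp add: ennreal_of_nat_eq_real_of_nat ennreal_mult)
    also have "\<dots> \<le> ennreal (e / 2)"
      using Union.prems by (intro ennreal_leI) (simp add: d_def field_simps)
    finally have *: "emeasure P (\<Union>j<m. (A j - B j) \<union> (B j - A j)) \<le> ennreal (e / 2)" .
    have "emeasure P ((\<Union>i. B i) - (\<Union>j<m. B j)) = ennreal (measure P (\<Union>i. B i) - measure P (\<Union>j<m. B j))"
      by (subst emeasure_eq_measure, subst finite_measure_Diff) auto
    also have "\<dots> \<le> ennreal (e / 2)" using m by (intro ennreal_leI) auto
    finally have **: "emeasure P ((\<Union>i. B i) - (\<Union>j<m. B j)) \<le> ennreal (e / 2)" .
    have "emeasure P (((\<Union>j<m. A j) - (\<Union>i. B i)) \<union> ((\<Union>i. B i) - (\<Union>j<m. A j)))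
      \<le> emeasure P ((\<Union>j<m. (A j - B j) \<union> (B j - A j)) \<union> ((\<Union>i. B i) - (\<Union>j<m. B j)))"
      by (intro emeasure_mono) auto
    also have "\<dots> \<le> emeasure P (\<Union>j<m. (A j - B j) \<union> (B j - A j)) + emeasure P ((\<Union>i. B i) - (\<Union>j<m. B j))"
      by (intro emeasure_subadditive) auto
    also have "\<dots> \<le> ennreal (e / 2) + ennreal (e / 2)"
      by (intro add_mono * **)
    also have "\<dots> = ennreal e"
      using Union.prems by (subst ennreal_plus[symmetric]) auto
    finally show ?case using AN
      by (intro exI[of _ N] bexI[of _ "\<Union>j<m. A j"]) auto
  qed
qed

text \<open>Closeness means that f and g differ only on a set of small probability. This notion
  survives multiplication by any constant, and sums cost only a union bound.\<close>

lemma law_simple_function_approx: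
  fixes f :: "(nat \<Rightarrow> 'a) \<Rightarrow> ennreal"
  assumes law: "law M P" and f: "simple_function P f" and e: "0 < (e::real)"
  shows "\<exists>n. \<exists>g\<in>borel_measurable (coord_filt M n). emeasure P {\<omega>\<in>space P. f \<omega> \<noteq> g \<omega>} \<le> ennreal e"
  using f e
proof (induction arbitrary: e rule: simple_function_induct_nn)
  case (cong f g)
  then have "{\<omega>\<in>space P. f \<omega> \<noteq> h \<omega>} = {\<omega>\<in>space P. g \<omega> \<noteq> h \<omega>}" for h by auto
  with cong.IH[OF cong.prems] show ?case by simp
next
  case (set B)
  obtain n A where A: "A \<in> sets (coord_filt M n)" "emeasure P ((A - B) \<union> (B - A)) \<le> ennreal e"
    using law_measure_approx[OF law set] by blast
  have "{\<omega>\<in>space P. indicator B \<omega> \<noteq> (indicator A \<omega> :: ennreal)} \<subseteq> (A - B) \<union> (B - A)"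
    by (auto simp: indicator_def)
  then have "emeasure P {\<omega>\<in>space P. indicator B \<omega> \<noteq> (indicator A \<omega> :: ennreal)} \<le> ennreal e"
    using A set sets_coord_filt_law[OF law A(1)] by (intro order_trans[OF emeasure_mono A(2)]) auto
  with A(1) show ?case by (intro exI[of _ n] bexI[of _ "indicator A"]) auto
next
  case (mult f c)
  obtain n g where g: "g \<in> borel_measurable (coord_filt M n)"
    "emeasure P {\<omega>\<in>space P. f \<omega> \<noteq> g \<omega>} \<le> ennreal e"
    using mult.IH[OF mult.prems] by blast
  have fg [measurable]: "f \<in> borel_measurable P" "g \<in> borel_measurable P"
    using mult.hyps(1) measurable_coord_filt_law[OF law g(1)] by (auto intro: borel_measurable_simple_function)
  have "{\<omega>\<in>space P. f \<omega> \<noteq> g \<omega>} \<in> sets P" by (rule borel_measurable_neq[OF fg])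
  then have "emeasure P {\<omega>\<in>space P. c * f \<omega> \<noteq> c * g \<omega>} \<le> emeasure P {\<omega>\<in>space P. f \<omega> \<noteq> g \<omega>}"
    by (intro emeasure_mono) auto
  with g show ?case by (intro exI[of _ n] bexI[of _ "\<lambda>\<omega>. c * g \<omega>"]) auto
next
  case (add f' f)
  have "0 < e / 2" using add.prems by simp
  obtain n g where g: "g \<in> borel_measurable (coord_filt M n)"
    "emeasure P {\<omega>\<in>space P. f \<omega> \<noteq> g \<omega>} \<le> ennreal (e / 2)"
    using add.IH(2)[OF \<open>0 < e / 2\<close>] by blast
  obtain n' g' where g': "g' \<in> borel_measurable (coord_filt M n')"
    "emeasure P {\<omega>\<in>space P. f' \<omega> \<noteq> g' \<omega>} \<le> ennreal (e / 2)"
    using add.IH(1)[OF \<open>0 < e / 2\<close>] by blast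
  have fg: "f \<in> borel_measurable P" "g \<in> borel_measurable P"
    "f' \<in> borel_measurable P" "g' \<in> borel_measurable P"
    using add.hyps(1,2) measurable_coord_filt_law[OF law g(1)] measurable_coord_filt_law[OF law g'(1)]
    by (auto intro: borel_measurable_simple_function)
  note sets = borel_measurable_neq[OF fg(1,2)] borel_measurable_neq[OF fg(3,4)]
  have "emeasure P {\<omega>\<in>space P. f \<omega> + f' \<omega> \<noteq> g \<omega> + g' \<omega>}
      \<le> emeasure P ({\<omega>\<in>space P. f \<omega> \<noteq> g \<omega>} \<union> {\<omega>\<in>space P. f' \<omega> \<noteq> g' \<omega>})"
    using sets by (intro emeasure_mono sets.Un) auto
  also have "\<dots> \<le> emeasure P {\<omega>\<in>space P. f \<omega> \<noteq> g \<omega>} + emeasure P {\<omega>\<in>space P. f' \<omega> \<noteq> g' \<omega>}"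
    using sets by (intro emeasure_subadditive) auto
  also have "\<dots> \<le> ennreal (e / 2) + ennreal (e / 2)"
    using g g' by (intro add_mono) auto
  also have "\<dots> = ennreal e" using add.prems by (subst ennreal_plus[symmetric]) auto
  finally have *: "emeasure P {\<omega>\<in>space P. f \<omega> + f' \<omega> \<noteq> g \<omega> + g' \<omega>} \<le> ennreal e" .
  have [measurable]: "g \<in> borel_measurable (coord_filt M (max n n'))"
    "g' \<in> borel_measurable (coord_filt M (max n n'))"
    using g(1) g'(1) by (auto intro: measurable_coord_filt_mono[rotated])
  show ?case using *
    by (intro exI[of _ "max n n'"] bexI[of _ "\<lambda>\<omega>. g \<omega> + g' \<omega>"]) auto
qed

text \<open>A maximal inequality whose level V is random but already known at time n: stop at the
  first time from n on at which X reaches V, and count only V of what is then held.\<close>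

lemma nn_supermartingale_maximal:
  assumes law: "law M P" and X: "\<And>t. X t \<in> borel_measurable (coord_filt M t)"
    and sm: "nn_supermartingale M P X" and V: "V \<in> borel_measurable (coord_filt M n)"
  shows "(\<integral>\<^sup>+\<omega>. V \<omega> * indicator {\<omega>\<in>space P. \<exists>t\<ge>n. V \<omega> \<le> X t \<omega>} \<omega> \<partial>P) \<le> (\<integral>\<^sup>+\<omega>. X n \<omega> \<partial>P)"
proof -
  define D where "D m = {\<omega>\<in>space P. \<exists>t\<in>{n..m}. V \<omega> \<le> X t \<omega>}" for m
  have DF: "D m \<in> sets (coord_filt M m)" if "n \<le> m" for m
  proof -
    have [measurable]: "V \<in> borel_measurable (coord_filt M m)"
      using measurable_coord_filt_mono[OF that V] .
    have X': "X t \<in> borel_measurable (coord_filt M m)" if "t \<in> {n..m}" for t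
      using measurable_coord_filt_mono[OF _ X] that by auto
    have "D m = (\<Union>t\<in>{n..m}. {\<omega>\<in>space (coord_filt M m). V \<omega> \<le> X t \<omega>})"
      by (auto simp: D_def space_law[OF law])
    also have "\<dots> \<in> sets (coord_filt M m)"
    proof (intro sets.finite_UN)
      fix t assume "t \<in> {n..m}"
      note X'[OF this, measurable]
      show "{\<omega>\<in>space (coord_filt M m). V \<omega> \<le> X t \<omega>} \<in> sets (coord_filt M m)" by measurable
    qed simp
    finally show ?thesis .
  qed
  have [measurable]: "D m \<in> sets P" for m
  proof (cases "n \<le> m")
    case True
    then show ?thesis using DF sets_coord_filt_law[OF law] by blast
  qed (auto simp: D_def)
  have [measurable]: "X t \<in> borel_measurable P" for t
    using measurable_coord_filt_law[OF law X] .
  have [measurable]: "V \<in> borel_measurable P"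
    using measurable_coord_filt_law[OF law V] .
  \<comment> \<open>The quantity is V once the level has been reached and X_m otherwise. It does not
    grow in expectation: where the level is reached exactly at time m + 1, X_(m+1) \<ge> V is
    replaced by V, and on the rest the supermartingale inequality applies with the F_m-measurable
    test function \<open>indicator (- D m)\<close>.\<close>
  have *: "(\<integral>\<^sup>+\<omega>. V \<omega> * indicator (D m) \<omega> + indicator (- D m) \<omega> * X m \<omega> \<partial>P) \<le> (\<integral>\<^sup>+\<omega>. X n \<omega> \<partial>P)" if "n \<le> m" for m
    using that
  proof (induction m rule: dec_induct)
    case base
    show ?case by (intro nn_integral_mono) (auto simp: D_def indicator_def)
  next
    case (step m)
    have [measurable]: "D m \<in> sets (coord_filt M m)" using DF step by simp
    have "(\<integral>\<^sup>+\<omega>. V \<omega> * indicator (D (Suc m)) \<omega> + indicator (- D (Suc m)) \<omega> * X (Suc m) \<omega> \<partial>P)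
      \<le> (\<integral>\<^sup>+\<omega>. V \<omega> * indicator (D m) \<omega> + indicator (- D m) \<omega> * X (Suc m) \<omega> \<partial>P)"
      by (intro nn_integral_mono) (auto simp: D_def indicator_def le_Suc_eq)
    also have "\<dots> = (\<integral>\<^sup>+\<omega>. V \<omega> * indicator (D m) \<omega> \<partial>P) + (\<integral>\<^sup>+\<omega>. indicator (- D m) \<omega> * X (Suc m) \<omega> \<partial>P)"
      by (intro nn_integral_add) auto
    also have "\<dots> \<le> (\<integral>\<^sup>+\<omega>. V \<omega> * indicator (D m) \<omega> \<partial>P) + (\<integral>\<^sup>+\<omega>. indicator (- D m) \<omega> * X m \<omega> \<partial>P)"
      by (intro add_left_mono nn_supermartingaleD[OF sm]) auto
    also have "\<dots> = (\<integral>\<^sup>+\<omega>. V \<omega> * indicator (D m) \<omega> + indicator (- D m) \<omega> * X m \<omega> \<partial>P)"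
      by (intro nn_integral_add[symmetric]) auto
    finally show ?case using step.IH by simp
  qed
  have "(\<integral>\<^sup>+\<omega>. V \<omega> * indicator {\<omega>\<in>space P. \<exists>t\<ge>n. V \<omega> \<le> X t \<omega>} \<omega> \<partial>P) = (\<integral>\<^sup>+\<omega>. (SUP m. V \<omega> * indicator (D m) \<omega>) \<partial>P)"
  proof (intro nn_integral_cong antisym)
    fix \<omega> assume \<omega>: "\<omega> \<in> space P"
    show "V \<omega> * indicator {\<omega>\<in>space P. \<exists>t\<ge>n. V \<omega> \<le> X t \<omega>} \<omega> \<le> (SUP m. V \<omega> * indicator (D m) \<omega>)"
    proof (cases "\<exists>t\<ge>n. V \<omega> \<le> X t \<omega>")
      case True
      then obtain t where "t \<ge> n" "V \<omega> \<le> X t \<omega>" by blast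
      then show ?thesis using \<omega> by (intro SUP_upper2[of t]) (auto simp: D_def indicator_def)
    qed simp
    show "(SUP m. V \<omega> * indicator (D m) \<omega>) \<le> V \<omega> * indicator {\<omega>\<in>space P. \<exists>t\<ge>n. V \<omega> \<le> X t \<omega>} \<omega>"
      by (intro SUP_least) (auto simp: D_def indicator_def)
  qed
  also have "\<dots> = (SUP m. \<integral>\<^sup>+\<omega>. V \<omega> * indicator (D m) \<omega> \<partial>P)"
  proof (rule nn_integral_monotone_convergence_SUP)
    show "incseq (\<lambda>m \<omega>. V \<omega> * indicator (D m) \<omega>)"
      by (auto simp: incseq_def le_fun_def D_def indicator_def)
  qed measurable
  also have "\<dots> \<le> (\<integral>\<^sup>+\<omega>. X n \<omega> \<partial>P)"
  proof (intro SUP_least)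
    fix m
    have "(\<integral>\<^sup>+\<omega>. V \<omega> * indicator (D m) \<omega> \<partial>P)
        \<le> (\<integral>\<^sup>+\<omega>. V \<omega> * indicator (D (max m n)) \<omega> + indicator (- D (max m n)) \<omega> * X (max m n) \<omega> \<partial>P)"
      by (intro nn_integral_mono) (auto simp: D_def indicator_def)
    also have "\<dots> \<le> (\<integral>\<^sup>+\<omega>. X n \<omega> \<partial>P)" by (rule *) simp
    finally show "(\<integral>\<^sup>+\<omega>. V \<omega> * indicator (D m) \<omega> \<partial>P) \<le> (\<integral>\<^sup>+\<omega>. X n \<omega> \<partial>P)" .
  qed
  finally show ?thesis .
qed

text \<open>Fatou's lemma controls only the limit inferior. Instead of proving almost sure convergence,
  we approximate a simple function below the limit superior by an \<open>F\<^sub>n\<close>-measurable one;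
  after time \<open>n\<close> the process exceeds it, up to an event of small probability,
  so that the maximal inequality applies.\<close>

lemma nn_supermartingale_limsup:
  assumes law: "law M P" and X: "\<And>t. X t \<in> borel_measurable (coord_filt M t)"
    and sm: "nn_supermartingale M P X"
  shows "(\<integral>\<^sup>+\<omega>. limsup (\<lambda>t. X t \<omega>) \<partial>P) \<le> (\<integral>\<^sup>+\<omega>. X 0 \<omega> \<partial>P)"
proof -
  let ?W = "\<lambda>\<omega>. limsup (\<lambda>t. X t \<omega>)" and ?a = "\<integral>\<^sup>+\<omega>. X 0 \<omega> \<partial>P"
  interpret prob_space P using law by (simp add: law_def)
  have XP [measurable]: "X t \<in> borel_measurable P" for t
    using measurable_coord_filt_law[OF law X] .
  \<comment> \<open>The factor q < 1 creates strictness: where g > 0, q g lies strictly below the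
    limit superior, so some X_t with t \<ge> n must exceed it, whatever n is.\<close>
  have key: "(\<integral>\<^sup>+\<omega>. ennreal q * g \<omega> \<partial>P) \<le> ?a"
    if g: "simple_function P g" "g \<le> ?W" "\<And>\<omega>. g \<omega> < top" and q: "0 < q" "q < 1" for g :: "_ \<Rightarrow> ennreal" and q :: real
  proof -
    have [measurable]: "g \<in> borel_measurable P" using g(1) by (rule borel_measurable_simple_function)
    \<comment> \<open>Adjoining 0 makes the maximum that of a nonempty finite set.\<close>
    define b where "b = Max (insert 0 (g ` space P))"
    have fin: "finite (insert 0 (g ` space P))" using g(1) by (simp add: simple_function_def)
    have gb: "g \<omega> \<le> b" if "\<omega> \<in> space P" for \<omega>
      using fin that by (auto simp: b_def intro: Max_ge)
    have "b \<in> insert 0 (g ` space P)" unfolding b_def using fin by (rule Max_in) simp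
    then have "b < top" using g(3) by auto
    show ?thesis
    proof (rule ennreal_le_epsilon)
      fix e :: real assume "0 < e"
      obtain r where r: "b = ennreal r" "0 \<le> r"
        using \<open>b < top\<close> by (cases b rule: ennreal_cases) auto
      \<comment> \<open>Chosen so that b d \<le> e, where b bounds g: on the exceptional event of
        probability at most d the integrand is estimated by b. The added 1 covers b = 0.\<close>
      define d where "d = e / (r + 1)"
      have "0 < d" using \<open>0 < e\<close> r(2) by (simp add: d_def)
      have "r * d \<le> e" using \<open>0 < e\<close> r(2) by (simp add: d_def divide_le_eq algebra_simps)
      then have bd: "b * ennreal d \<le> ennreal e"
        using r \<open>0 < d\<close> by (simp add: ennreal_leI flip: ennreal_mult)
      obtain n V where V: "V \<in> borel_measurable (coord_filt M n)"
        "emeasure P {\<omega>\<in>space P. ennreal q * g \<omega> \<noteq> V \<omega>} \<le> ennreal d"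
        using law_simple_function_approx[OF law simple_function_mult[OF simple_function_const g(1)] \<open>0 < d\<close>]
        by blast
      have VP [measurable]: "V \<in> borel_measurable P" using measurable_coord_filt_law[OF law V(1)] .
      let ?N = "{\<omega>\<in>space P. ennreal q * g \<omega> \<noteq> V \<omega>}"
      \<comment> \<open>Outside \<open>?N\<close> the approximation V equals q g, and the event of
        the maximal inequality occurs unless g = 0; on \<open>?N\<close> only q g \<le> g \<le> b is
        used.\<close>
      have le: "ennreal q * g \<omega> \<le> V \<omega> * indicator {\<omega>\<in>space P. \<exists>t\<ge>n. V \<omega> \<le> X t \<omega>} \<omega> + b * indicator ?N \<omega>"
        if \<omega>: "\<omega> \<in> space P" for \<omega>
      proof (cases "\<omega> \<in> ?N \<or> g \<omega> = 0")
        case True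
        have "ennreal q * g \<omega> \<le> 1 * g \<omega>" using q by (intro mult_right_mono) (auto simp: ennreal_le_1)
        with gb[OF \<omega>] True show ?thesis by (auto simp: add_increasing)
      next
        case False
        have "ennreal q * g \<omega> < g \<omega>"
        proof -
          obtain r where r: "g \<omega> = ennreal r" "0 \<le> r"
            using g(3)[of \<omega>] by (cases "g \<omega>" rule: ennreal_cases) auto
          then have "0 < r" using False by (cases "r = 0") auto
          then have "ennreal q * ennreal r = ennreal (q * r)" "q * r < r"
            using q by (auto simp: ennreal_mult)
          then show ?thesis using r \<open>0 < r\<close> by (simp add: ennreal_lessI)
        qed
        then have "V \<omega> < ?W \<omega>" using False \<omega> g(2) by (auto simp: le_fun_def intro: less_le_trans)
        also have "?W \<omega> \<le> (SUP t\<in>{n..}. X t \<omega>)"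
          unfolding limsup_INF_SUP by (rule INF_lower) simp
        finally obtain t where "n \<le> t" "V \<omega> < X t \<omega>" by (auto simp: less_SUP_iff)
        then have "\<exists>t\<ge>n. V \<omega> \<le> X t \<omega>" by (auto intro: less_imp_le)
        then show ?thesis using False \<omega> by (simp add: indicator_def)
      qed
      let ?D = "{\<omega>\<in>space P. \<exists>t\<ge>n. V \<omega> \<le> X t \<omega>}"
      have "?D = (\<Union>t\<in>{n..}. {\<omega>\<in>space P. V \<omega> \<le> X t \<omega>})" by auto
      also have "\<dots> \<in> sets P"
        by (intro sets.countable_UN' borel_measurable_le VP XP) auto
      finally have D: "?D \<in> sets P" .
      have N: "?N \<in> sets P"
        by (intro borel_measurable_neq VP borel_measurable_times_ennreal) auto
      have "(\<integral>\<^sup>+\<omega>. ennreal q * g \<omega> \<partial>P)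
          \<le> (\<integral>\<^sup>+\<omega>. V \<omega> * indicator {\<omega>\<in>space P. \<exists>t\<ge>n. V \<omega> \<le> X t \<omega>} \<omega> + b * indicator ?N \<omega> \<partial>P)"
        using le by (rule nn_integral_mono)
      also have "\<dots> = (\<integral>\<^sup>+\<omega>. V \<omega> * indicator {\<omega>\<in>space P. \<exists>t\<ge>n. V \<omega> \<le> X t \<omega>} \<omega> \<partial>P) + b * emeasure P ?N"
        using nn_integral_add[OF borel_measurable_times_ennreal[OF VP borel_measurable_indicator[OF D]]
          borel_measurable_times_ennreal[OF borel_measurable_const borel_measurable_indicator[OF N], of b]]
          nn_integral_cmult_indicator[OF N, of b] by simp
      also have "\<dots> \<le> ?a + ennreal e"
      proof (rule add_mono)
        have "(\<integral>\<^sup>+\<omega>. X n \<omega> \<partial>P) \<le> ?a"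
          using nn_supermartingaleD[OF sm, of 0 n "\<lambda>_. 1"] by simp
        then show "(\<integral>\<^sup>+\<omega>. V \<omega> * indicator {\<omega>\<in>space P. \<exists>t\<ge>n. V \<omega> \<le> X t \<omega>} \<omega> \<partial>P) \<le> ?a"
          using nn_supermartingale_maximal[OF law X sm V(1)] by simp
        have "b * emeasure P ?N \<le> b * ennreal d" using V(2) by (intro mult_left_mono) auto
        with bd show "b * emeasure P ?N \<le> ennreal e" by simp
      qed
      finally show "(\<integral>\<^sup>+\<omega>. ennreal q * g \<omega> \<partial>P) \<le> ?a + ennreal e" .
    qed
  qed
  \<comment> \<open>Now q tends to 1, and finite-valued simple functions below the limit superior
    exhaust its integral.\<close>
  have "(\<integral>\<^sup>+\<omega>. g \<omega> \<partial>P) \<le> ?a"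
    if g: "simple_function P g" "g \<le> ?W" "\<And>\<omega>. g \<omega> < top" for g
  proof -
    have [measurable]: "g \<in> borel_measurable P" using g(1) by (rule borel_measurable_simple_function)
    have *: "ennreal q * (\<integral>\<^sup>+\<omega>. g \<omega> \<partial>P) \<le> ?a" if "0 < q" "q < 1" for q
      using key[OF g that] by (simp add: nn_integral_cmult)
    show ?thesis
    proof (cases "\<integral>\<^sup>+\<omega>. g \<omega> \<partial>P" rule: ennreal_cases)
      case (real i)
      show ?thesis
      proof (cases ?a rule: ennreal_cases)
        case (real a)
        have "q * i \<le> a" if "0 < q" "q < 1" for q
          using *[OF that] that \<open>0 \<le> i\<close> real \<open>(\<integral>\<^sup>+\<omega>. g \<omega> \<partial>P) = ennreal i\<close>
          by (simp flip: ennreal_mult)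
        then have "i \<le> a" by (rule field_le_mult_one_interval)
        then show ?thesis using real \<open>(\<integral>\<^sup>+\<omega>. g \<omega> \<partial>P) = ennreal i\<close> by (simp add: ennreal_leI)
      qed simp
    next
      case top
      then show ?thesis using *[of "1 / 2"] by (simp add: ennreal_mult_top top_unique)
    qed
  qed
  then show ?thesis
    unfolding nn_integral_def_finite[of P ?W]
    by (intro SUP_least) (auto simp: nn_integral_eq_simple_integral[symmetric])
qed

section \<open>Stopped processes and optional stopping\<close>

text \<open>Recursive form of the process frozen at \<tau>. The value at t + 1 is decided by whether
  \<tau> \<le> t, an event of F_t; this makes both measurability and the supermartingale step
  inductions on t.\<close>

fun stopped_process :: "(nat \<Rightarrow> 'b \<Rightarrow> 'c) \<Rightarrow> ('b \<Rightarrow> enat) \<Rightarrow> nat \<Rightarrow> 'b \<Rightarrow> 'c" where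
  "stopped_process L \<tau> 0 = L 0"
| "stopped_process L \<tau> (Suc t) = (\<lambda>\<omega>. if \<tau> \<omega> \<le> enat t then stopped_process L \<tau> t \<omega> else L (Suc t) \<omega>)"

lemma stopped_process_eq:
  "stopped_process L \<tau> t \<omega> = L (case \<tau> \<omega> of enat n \<Rightarrow> min n t | \<infinity> \<Rightarrow> t) \<omega>"
  by (induction t) (auto split: enat.splits simp: min_def le_Suc_eq)

lemma stopped_eq_limsup:
  "stopped L \<tau> \<omega> = limsup (\<lambda>t. stopped_process (\<lambda>t \<omega>. ennreal (L t \<omega>)) \<tau> t \<omega>)"
proof (cases "\<tau> \<omega>")
  case (enat n)
  have "(\<lambda>t. stopped_process (\<lambda>t \<omega>. ennreal (L t \<omega>)) \<tau> t \<omega>) \<longlonglongrightarrow> ennreal (L n \<omega>)"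
    by (rule tendsto_eventually)
       (auto simp: stopped_process_eq enat eventually_sequentially min_def intro!: exI[of _ n] dest: antisym)
  then show ?thesis by (simp add: stopped_def enat lim_imp_Limsup)
qed (simp add: stopped_def stopped_process_eq)

lemma seq_stopping_time_pred:
  assumes "seq_stopping_time M \<tau>"
  shows "Measurable.pred (coord_filt M t) (\<lambda>\<omega>. \<tau> \<omega> \<le> enat t)"
  using stopping_timeD[OF assms[unfolded seq_stopping_time_def], of "enat t"] by simp

lemma stopped_process_measurable:
  assumes "seq_stopping_time M \<tau>" "\<And>t. L t \<in> borel_measurable (coord_filt M t)"
  shows "stopped_process L \<tau> t \<in> borel_measurable (coord_filt M t)"
proof (induction t)
  case (Suc t)
  have [measurable]: "L (Suc t) \<in> borel_measurable (coord_filt M (Suc t))" by fact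
  have [measurable]: "stopped_process L \<tau> t \<in> borel_measurable (coord_filt M (Suc t))"
    "Measurable.pred (coord_filt M (Suc t)) (\<lambda>\<omega>. \<tau> \<omega> \<le> enat t)"
    by (rule measurable_coord_filt_mono[of t], simp, fact Suc.IH)
       (rule measurable_coord_filt_mono[of t], simp, rule seq_stopping_time_pred[OF assms(1)])
  show ?case by simp
qed (use assms in simp)

lemma stopped_measurable:
  assumes "law M P" "seq_stopping_time M \<tau>" "nonneg_adapted M E"
  shows "stopped E \<tau> \<in> borel_measurable P"
proof -
  have "(\<lambda>\<omega>. ennreal (E t \<omega>)) \<in> borel_measurable (coord_filt M t)" for t
    using assms(3) by (intro measurable_compose[OF _ measurable_ennreal]) (simp add: nonneg_adapted_def)
  from measurable_coord_filt_law[OF assms(1) stopped_process_measurable[OF assms(2) this]]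
  have [measurable]: "stopped_process (\<lambda>t \<omega>. ennreal (E t \<omega>)) \<tau> t \<in> borel_measurable P" for t .
  then show ?thesis
    unfolding stopped_eq_limsup[abs_def] by measurable
qed

lemma nn_supermartingale_stopped:
  assumes law: "law M P" and \<tau>: "seq_stopping_time M \<tau>" and L: "nonneg_adapted M L"
    and sm: "nn_supermartingale M P (\<lambda>t \<omega>. ennreal (L t \<omega>))"
  shows "(\<integral>\<^sup>+\<omega>. stopped L \<tau> \<omega> \<partial>P) \<le> (\<integral>\<^sup>+\<omega>. ennreal (L 0 \<omega>) \<partial>P)"
proof -
  let ?L = "\<lambda>t \<omega>. ennreal (L t \<omega>)"
  let ?X = "stopped_process ?L \<tau>"
  have LF [measurable]: "?L t \<in> borel_measurable (coord_filt M t)" for t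
    using L by (intro measurable_compose[OF _ measurable_ennreal]) (simp add: nonneg_adapted_def)
  have X [measurable]: "?X t \<in> borel_measurable (coord_filt M t)" for t
    by (rule stopped_process_measurable[OF \<tau> LF])
  have [measurable]: "?L t \<in> borel_measurable P" "?X t \<in> borel_measurable P" for t
    using measurable_coord_filt_law[OF law LF] measurable_coord_filt_law[OF law X] by auto
  have "nn_supermartingale M P ?X"
  proof (rule nn_supermartingale_SucI)
    fix t and g :: "(nat \<Rightarrow> 'a) \<Rightarrow> ennreal" assume g [measurable]: "g \<in> borel_measurable (coord_filt M t)"
    have [measurable]: "g \<in> borel_measurable P" by (rule measurable_coord_filt_law[OF law g])
    define B where "B = {\<omega>\<in>space P. \<tau> \<omega> \<le> enat t}"
    have B [measurable]: "B \<in> sets (coord_filt M t)"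
      using seq_stopping_time_pred[OF \<tau>, of t] by (simp add: B_def pred_def space_law[OF law])
    have [measurable]: "B \<in> sets P" by (rule sets_coord_filt_law[OF law B])
    have "(\<integral>\<^sup>+\<omega>. g \<omega> * ?X (Suc t) \<omega> \<partial>P)
        = (\<integral>\<^sup>+\<omega>. g \<omega> * indicator B \<omega> * ?X t \<omega> + g \<omega> * indicator (- B) \<omega> * ?L (Suc t) \<omega> \<partial>P)"
      by (intro nn_integral_cong) (auto simp: B_def indicator_def)
    also have "\<dots> = (\<integral>\<^sup>+\<omega>. g \<omega> * indicator B \<omega> * ?X t \<omega> \<partial>P) + (\<integral>\<^sup>+\<omega>. g \<omega> * indicator (- B) \<omega> * ?L (Suc t) \<omega> \<partial>P)"
      by (intro nn_integral_add) auto
    also have "\<dots> \<le> (\<integral>\<^sup>+\<omega>. g \<omega> * indicator B \<omega> * ?X t \<omega> \<partial>P) + (\<integral>\<^sup>+\<omega>. g \<omega> * indicator (- B) \<omega> * ?L t \<omega> \<partial>P)"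
      by (intro add_left_mono nn_supermartingaleD[OF sm]) auto
    also have "\<dots> = (\<integral>\<^sup>+\<omega>. g \<omega> * indicator B \<omega> * ?X t \<omega> + g \<omega> * indicator (- B) \<omega> * ?L t \<omega> \<partial>P)"
      by (intro nn_integral_add[symmetric]) auto
    also have "\<dots> = (\<integral>\<^sup>+\<omega>. g \<omega> * ?X t \<omega> \<partial>P)"
    proof (intro nn_integral_cong)
      fix \<omega> assume \<omega>: "\<omega> \<in> space P"
      have "?X t \<omega> = ?L t \<omega>" if "\<omega> \<notin> B"
        using that \<omega> by (auto simp: B_def stopped_process_eq min_def split: enat.splits)
      then show "g \<omega> * indicator B \<omega> * ?X t \<omega> + g \<omega> * indicator (- B) \<omega> * ?L t \<omega> = g \<omega> * ?X t \<omega>"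
        by (auto simp: indicator_def)
    qed
    finally show "(\<integral>\<^sup>+\<omega>. g \<omega> * ?X (Suc t) \<omega> \<partial>P) \<le> (\<integral>\<^sup>+\<omega>. g \<omega> * ?X t \<omega> \<partial>P)" .
  qed
  from nn_supermartingale_limsup[OF law X this] show ?thesis
    by (simp add: stopped_eq_limsup[abs_def])
qed

section \<open>Likelihood ratios\<close>

lemma likelihood_ratio_nonneg [simp]: "0 \<le> likelihood_ratio M R P t \<omega>"
  by (simp add: likelihood_ratio_def)

lemma likelihood_ratio_measurable:
  assumes "law M R"
  shows "likelihood_ratio M R P t \<in> borel_measurable (coord_filt M t)"
  unfolding likelihood_ratio_def[abs_def]
  by (rule measurable_in_subalg'[OF subalgebra_law[OF assms]]) simp

lemma prob_space_restr_law: "law M P \<Longrightarrow> prob_space (restr_to_subalg P (coord_filt M t))"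
  by (intro prob_space_restr_to_subalg subalgebra_law) (auto simp: law_def)

lemma sets_restr_law: "law M P \<Longrightarrow> sets (restr_to_subalg P (coord_filt M t)) = sets (coord_filt M t)"
  by (intro sets_restr_to_subalg subalgebra_law)

text \<open>The Radon-Nikodym derivative of a finite measure is finite almost everywhere, so the
  real-valued version of the density loses nothing. The identity is confined to F_t, where
  domination holds.\<close>

lemma nn_integral_likelihood_ratio:
  assumes R: "law M R" and P: "law M P" and ld: "locally_dominated M R P"
    and f: "f \<in> borel_measurable (coord_filt M t)"
  shows "(\<integral>\<^sup>+\<omega>. f \<omega> \<partial>P) = (\<integral>\<^sup>+\<omega>. f \<omega> * ennreal (likelihood_ratio M R P t \<omega>) \<partial>R)"
proof -
  let ?F = "coord_filt M t"
  let ?R = "restr_to_subalg R ?F" and ?P = "restr_to_subalg P ?F"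
  interpret R': prob_space ?R by (rule prob_space_restr_law[OF R])
  interpret P': prob_space ?P by (rule prob_space_restr_law[OF P])
  have ac: "absolutely_continuous ?R ?P" using ld by (auto simp: locally_dominated_def)
  have sets: "sets ?P = sets ?R" using R P by (simp add: sets_restr_law)
  have fR: "f \<in> borel_measurable ?R" by (rule measurable_in_subalg[OF subalgebra_law[OF R] f])
  have "(\<integral>\<^sup>+\<omega>. f \<omega> \<partial>P) = (\<integral>\<^sup>+\<omega>. f \<omega> \<partial>?P)"
    by (rule nn_integral_subalgebra2[OF subalgebra_law[OF P] f, symmetric])
  also have "\<dots> = (\<integral>\<^sup>+\<omega>. RN_deriv ?R ?P \<omega> * f \<omega> \<partial>?R)"
    by (rule R'.RN_deriv_nn_integral[OF ac sets fR])
  also have "\<dots> = (\<integral>\<^sup>+\<omega>. f \<omega> * ennreal (likelihood_ratio M R P t \<omega>) \<partial>?R)"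
  proof (rule nn_integral_cong_AE)
    have "AE \<omega> in ?R. RN_deriv ?R ?P \<omega> \<noteq> \<infinity>"
      by (rule R'.RN_deriv_finite[OF _ ac sets]) unfold_locales
    then show "AE \<omega> in ?R. RN_deriv ?R ?P \<omega> * f \<omega> = f \<omega> * ennreal (likelihood_ratio M R P t \<omega>)"
      by eventually_elim (simp add: likelihood_ratio_def less_top mult.commute)
  qed
  also have "\<dots> = (\<integral>\<^sup>+\<omega>. f \<omega> * ennreal (likelihood_ratio M R P t \<omega>) \<partial>R)"
    using f likelihood_ratio_measurable[OF R, of P t]
    by (intro nn_integral_subalgebra2[OF subalgebra_law[OF R]]) simp
  finally show ?thesis .
qed

text \<open>Identifies the chosen version of the density with any explicit one; needed to recognise
  a constructed measure as a fork-convex combination.\<close>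

lemma likelihood_ratio_unique:
  assumes R: "law M R" and P: "law M P"
    and g: "g \<in> borel_measurable (coord_filt M t)" and nn: "\<And>\<omega>. \<omega> \<in> space R \<Longrightarrow> 0 \<le> g \<omega>"
    and eq: "\<And>A. A \<in> sets (coord_filt M t) \<Longrightarrow> emeasure P A = (\<integral>\<^sup>+\<omega>. indicator A \<omega> * ennreal (g \<omega>) \<partial>R)"
  shows "AE \<omega> in R. likelihood_ratio M R P t \<omega> = g \<omega>"
proof -
  let ?F = "coord_filt M t"
  let ?R = "restr_to_subalg R ?F" and ?P = "restr_to_subalg P ?F"
  interpret R': prob_space ?R by (rule prob_space_restr_law[OF R])
  have gR: "(\<lambda>\<omega>. ennreal (g \<omega>)) \<in> borel_measurable ?R"
    using g by (intro measurable_in_subalg[OF subalgebra_law[OF R]]) simp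
  have "density ?R (\<lambda>\<omega>. ennreal (g \<omega>)) = ?P"
  proof (rule measure_eqI)
    fix A assume "A \<in> sets (density ?R (\<lambda>\<omega>. ennreal (g \<omega>)))"
    then have A: "A \<in> sets ?R" and AF: "A \<in> sets ?F" using R by (auto simp: sets_restr_law)
    have "emeasure (density ?R (\<lambda>\<omega>. ennreal (g \<omega>))) A = (\<integral>\<^sup>+\<omega>. indicator A \<omega> * ennreal (g \<omega>) \<partial>?R)"
      by (simp add: emeasure_density[OF gR A] mult.commute)
    also have "\<dots> = (\<integral>\<^sup>+\<omega>. indicator A \<omega> * ennreal (g \<omega>) \<partial>R)"
      using g AF by (intro nn_integral_subalgebra2[OF subalgebra_law[OF R]]) simp
    also have "\<dots> = emeasure ?P A"
      using AF by (simp add: eq emeasure_restr_to_subalg[OF subalgebra_law[OF P]])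
    finally show "emeasure (density ?R (\<lambda>\<omega>. ennreal (g \<omega>))) A = emeasure ?P A" .
  qed (use R P in \<open>simp add: sets_restr_law\<close>)
  from AE_restr_to_subalg[OF subalgebra_law[OF R] R'.RN_deriv_unique[OF gR this]] AE_space
  show ?thesis
    by eventually_elim (metis enn2real_ennreal likelihood_ratio_def nn)
qed

text \<open>Domination compares the laws on each F_t only; on the whole sequence space P may be
  singular to R. Hence the restriction to properties measurable at a finite time.\<close>

lemma AE_locally_dominated:
  assumes R: "law M R" and P: "law M P" and ld: "locally_dominated M R P"
    and Q: "Measurable.pred (coord_filt M t) Q" and AE: "AE \<omega> in R. Q \<omega>"
  shows "AE \<omega> in P. Q \<omega>"
proof -
  let ?F = "coord_filt M t"
  have "AE \<omega> in restr_to_subalg R ?F. Q \<omega>"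
    by (rule AE_restr_to_subalg2[OF subalgebra_law[OF R] AE Q])
  then have "AE \<omega> in restr_to_subalg P ?F. Q \<omega>"
    using ld R P by (intro absolutely_continuous_AE[of "restr_to_subalg P ?F" "restr_to_subalg R ?F"])
      (auto simp: sets_restr_law locally_dominated_def)
  then show ?thesis by (rule AE_restr_to_subalg[OF subalgebra_law[OF P]])
qed

text \<open>The event {Z_t = 0} has probability E_R[1_A Z_t] = 0 under P. Setting a function to 0
  there is therefore invisible to P.\<close>

lemma AE_likelihood_ratio_pos:
  assumes R: "law M R" and P: "law M P" and ld: "locally_dominated M R P"
  shows "AE \<omega> in P. 0 < likelihood_ratio M R P t \<omega>"
proof -
  let ?Z = "likelihood_ratio M R P t"
  define A where "A = {\<omega>\<in>space (coord_filt M t). \<not> 0 < ?Z \<omega>}"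
  note likelihood_ratio_measurable[OF R, measurable]
  have A: "A \<in> sets (coord_filt M t)" unfolding A_def by measurable
  have "emeasure P A = (\<integral>\<^sup>+\<omega>. indicator A \<omega> \<partial>P)"
    by (simp add: sets_coord_filt_law[OF P A])
  also have "\<dots> = (\<integral>\<^sup>+\<omega>. indicator A \<omega> * ennreal (?Z \<omega>) \<partial>R)"
    using A by (intro nn_integral_likelihood_ratio[OF R P ld]) simp
  also have "\<dots> = (\<integral>\<^sup>+\<omega>. 0 \<partial>R)"
    by (intro nn_integral_cong) (auto simp: A_def indicator_def not_less intro: ennreal_neg antisym)
  finally have "A \<in> null_sets P" using sets_coord_filt_law[OF P A] by (auto simp: null_sets_def)
  then show ?thesis by (rule AE_I') (simp add: A_def space_law[OF P])
qed

text \<open>Pointwise, f Z \<le> f Z' + c |Z - Z'|. This is the quantitative continuity of bounded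
  expectations on which every passage to the closure depends.\<close>

lemma nn_integral_le_likelihood_ratio_dist:
  assumes R: "law M R" and P: "law M P" "locally_dominated M R P"
    and Q: "law M Q" "locally_dominated M R Q"
    and f: "f \<in> borel_measurable (coord_filt M t)" and le: "\<And>\<omega>. f \<omega> \<le> c"
  shows "(\<integral>\<^sup>+\<omega>. f \<omega> \<partial>P) \<le> (\<integral>\<^sup>+\<omega>. f \<omega> \<partial>Q)
    + c * (\<integral>\<^sup>+\<omega>. ennreal \<bar>likelihood_ratio M R P t \<omega> - likelihood_ratio M R Q t \<omega>\<bar> \<partial>R)"
proof -
  let ?Z = "likelihood_ratio M R P t" and ?Z' = "likelihood_ratio M R Q t"
  have m [measurable]: "?Z \<in> borel_measurable R" "?Z' \<in> borel_measurable R" "f \<in> borel_measurable R"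
    using likelihood_ratio_measurable[OF R] f measurable_coord_filt_law[OF R] by blast+
  have "(\<integral>\<^sup>+\<omega>. f \<omega> \<partial>P) = (\<integral>\<^sup>+\<omega>. f \<omega> * ennreal (?Z \<omega>) \<partial>R)"
    by (rule nn_integral_likelihood_ratio[OF R P f])
  also have "\<dots> \<le> (\<integral>\<^sup>+\<omega>. f \<omega> * ennreal (?Z' \<omega>) + c * ennreal \<bar>?Z \<omega> - ?Z' \<omega>\<bar> \<partial>R)"
  proof (rule nn_integral_mono)
    fix \<omega>
    have "ennreal (?Z \<omega>) \<le> ennreal (?Z' \<omega> + \<bar>?Z \<omega> - ?Z' \<omega>\<bar>)" by (intro ennreal_leI) auto
    then have "f \<omega> * ennreal (?Z \<omega>) \<le> f \<omega> * (ennreal (?Z' \<omega>) + ennreal \<bar>?Z \<omega> - ?Z' \<omega>\<bar>)"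
      by (intro mult_left_mono) (auto simp: ennreal_plus)
    also have "\<dots> \<le> f \<omega> * ennreal (?Z' \<omega>) + c * ennreal \<bar>?Z \<omega> - ?Z' \<omega>\<bar>"
      by (simp add: distrib_left add_left_mono mult_right_mono le)
    finally show "f \<omega> * ennreal (?Z \<omega>) \<le> f \<omega> * ennreal (?Z' \<omega>) + c * ennreal \<bar>?Z \<omega> - ?Z' \<omega>\<bar>" .
  qed
  also have "\<dots> = (\<integral>\<^sup>+\<omega>. f \<omega> * ennreal (?Z' \<omega>) \<partial>R) + c * (\<integral>\<^sup>+\<omega>. ennreal \<bar>?Z \<omega> - ?Z' \<omega>\<bar> \<partial>R)"
    by (simp add: nn_integral_add nn_integral_cmult)
  also have "(\<integral>\<^sup>+\<omega>. f \<omega> * ennreal (?Z' \<omega>) \<partial>R) = (\<integral>\<^sup>+\<omega>. f \<omega> \<partial>Q)"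
    by (rule nn_integral_likelihood_ratio[OF R Q f, symmetric])
  finally show ?thesis .
qed

section \<open>Fork-convex combinations\<close>

text \<open>The density that the Q'-part of a combination carries relative to Q'. Being known at
  time s, it converts Z'_t into (1 - h) Z_s Z'_t / Z'_s. Where Z'_s = 0, division in HOL gives 0, in
  harmony with h = 1 there.\<close>

definition fork_weight ::
    "'a measure \<Rightarrow> (nat \<Rightarrow> 'a) measure \<Rightarrow> (nat \<Rightarrow> 'a) measure \<Rightarrow> (nat \<Rightarrow> 'a) measure \<Rightarrow>
     nat \<Rightarrow> ((nat \<Rightarrow> 'a) \<Rightarrow> real) \<Rightarrow> (nat \<Rightarrow> 'a) \<Rightarrow> real" where
  "fork_weight M R Q Q' s h \<omega> =
     (1 - h \<omega>) * (likelihood_ratio M R Q s \<omega> / likelihood_ratio M R Q' s \<omega>)"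

lemma fork_weight_measurable:
  assumes "law M R" and "h \<in> borel_measurable (coord_filt M s)"
  shows "fork_weight M R Q Q' s h \<in> borel_measurable (coord_filt M s)"
  unfolding fork_weight_def[abs_def]
  using assms(2) likelihood_ratio_measurable[OF assms(1)] by simp

lemma fork_nn_integral:
  assumes R: "law M R" and Q: "law M Q" "locally_dominated M R Q"
    and Q': "law M Q'" "locally_dominated M R Q'"
    and h: "h \<in> borel_measurable (coord_filt M s)"
    and h01: "\<And>\<omega>. \<omega> \<in> space (seq_space M) \<Longrightarrow> 0 \<le> h \<omega> \<and> h \<omega> \<le> 1"
    and h1: "AE \<omega> in R. likelihood_ratio M R Q' s \<omega> = 0 \<longrightarrow> h \<omega> = 1"
    and t: "s \<le> t" and f: "f \<in> borel_measurable (coord_filt M t)"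
  shows "(\<integral>\<^sup>+\<omega>. ennreal (h \<omega>) * f \<omega> \<partial>Q) + (\<integral>\<^sup>+\<omega>. ennreal (fork_weight M R Q Q' s h \<omega>) * f \<omega> \<partial>Q')
    = (\<integral>\<^sup>+\<omega>. f \<omega> * ennreal (h \<omega> * likelihood_ratio M R Q t \<omega> +
              (1 - h \<omega>) * likelihood_ratio M R Q s \<omega> *
                fork_ratio (likelihood_ratio M R Q' t \<omega>) (likelihood_ratio M R Q' s \<omega>)) \<partial>R)"
    (is "?a + ?b = _")
proof -
  let ?Z = "likelihood_ratio M R Q" and ?Z' = "likelihood_ratio M R Q'"
  let ?k = "fork_weight M R Q Q' s h"
  have ht: "h \<in> borel_measurable (coord_filt M t)"
    by (rule measurable_coord_filt_mono[OF t h])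
  have kt: "?k \<in> borel_measurable (coord_filt M t)"
    by (rule measurable_coord_filt_mono[OF t fork_weight_measurable[OF R h]])
  have [measurable]: "h \<in> borel_measurable R" "?k \<in> borel_measurable R" "f \<in> borel_measurable R"
    "?Z t \<in> borel_measurable R" "?Z' t \<in> borel_measurable R"
    using measurable_coord_filt_law[OF R] ht kt f likelihood_ratio_measurable[OF R] by blast+
  have "?a = (\<integral>\<^sup>+\<omega>. ennreal (h \<omega>) * f \<omega> * ennreal (?Z t \<omega>) \<partial>R)"
    by (rule nn_integral_likelihood_ratio[OF R Q]) (use ht f in simp)
  moreover have "?b = (\<integral>\<^sup>+\<omega>. ennreal (?k \<omega>) * f \<omega> * ennreal (?Z' t \<omega>) \<partial>R)"
    by (rule nn_integral_likelihood_ratio[OF R Q']) (use kt f in simp)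
  ultimately have "?a + ?b = (\<integral>\<^sup>+\<omega>. ennreal (h \<omega>) * f \<omega> * ennreal (?Z t \<omega>)
      + ennreal (?k \<omega>) * f \<omega> * ennreal (?Z' t \<omega>) \<partial>R)"
    by (simp add: nn_integral_add)
  also have "\<dots> = (\<integral>\<^sup>+\<omega>. f \<omega> * ennreal (h \<omega> * ?Z t \<omega> +
      (1 - h \<omega>) * ?Z s \<omega> * fork_ratio (?Z' t \<omega>) (?Z' s \<omega>)) \<partial>R)"
  proof (rule nn_integral_cong_AE)
    from h1 AE_space show "AE \<omega> in R. ennreal (h \<omega>) * f \<omega> * ennreal (?Z t \<omega>)
      + ennreal (?k \<omega>) * f \<omega> * ennreal (?Z' t \<omega>) = f \<omega> * ennreal (h \<omega> * ?Z t \<omega> +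
      (1 - h \<omega>) * ?Z s \<omega> * fork_ratio (?Z' t \<omega>) (?Z' s \<omega>))"
    proof eventually_elim
      case (elim \<omega>)
      have h: "0 \<le> h \<omega>" "h \<omega> \<le> 1" using h01[of \<omega>] elim(2) by (auto simp: space_law[OF R])
      have k: "0 \<le> ?k \<omega>" using h by (simp add: fork_weight_def)
      have "ennreal (h \<omega>) * f \<omega> * ennreal (?Z t \<omega>) + ennreal (?k \<omega>) * f \<omega> * ennreal (?Z' t \<omega>)
        = f \<omega> * (ennreal (h \<omega>) * ennreal (?Z t \<omega>) + ennreal (?k \<omega>) * ennreal (?Z' t \<omega>))"
        by (simp add: algebra_simps)
      also have "ennreal (h \<omega>) * ennreal (?Z t \<omega>) + ennreal (?k \<omega>) * ennreal (?Z' t \<omega>)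
        = ennreal (h \<omega> * ?Z t \<omega> + ?k \<omega> * ?Z' t \<omega>)"
        using h k by (simp add: ennreal_mult ennreal_plus)
      \<comment> \<open>Where Z'_s = 0 the factor 1 - h vanishes and both sides are 0, so the two
        conventions for division by 0 never meet.\<close>
      also have "?k \<omega> * ?Z' t \<omega> = (1 - h \<omega>) * ?Z s \<omega> * fork_ratio (?Z' t \<omega>) (?Z' s \<omega>)"
        using elim(1) by (auto simp: fork_weight_def fork_ratio_def)
      finally show ?case .
    qed
  qed
  finally show ?thesis .
qed

text \<open>At t = s the ratio Z'_s / Z'_s is 1, also by the convention 0/0 = 1, and h Z_s + (1 - h)
  Z_s = Z_s. Thus the fork does not alter the law before the switch.\<close>

lemma fork_nn_integral_past:
  assumes R: "law M R" and Q: "law M Q" "locally_dominated M R Q"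
    and Q': "law M Q'" "locally_dominated M R Q'"
    and h: "h \<in> borel_measurable (coord_filt M s)"
    and h01: "\<And>\<omega>. \<omega> \<in> space (seq_space M) \<Longrightarrow> 0 \<le> h \<omega> \<and> h \<omega> \<le> 1"
    and h1: "AE \<omega> in R. likelihood_ratio M R Q' s \<omega> = 0 \<longrightarrow> h \<omega> = 1"
    and t: "t \<le> s" and f: "f \<in> borel_measurable (coord_filt M t)"
  shows "(\<integral>\<^sup>+\<omega>. ennreal (h \<omega>) * f \<omega> \<partial>Q) + (\<integral>\<^sup>+\<omega>. ennreal (fork_weight M R Q Q' s h \<omega>) * f \<omega> \<partial>Q')
    = (\<integral>\<^sup>+\<omega>. f \<omega> \<partial>Q)"
proof -
  have fs: "f \<in> borel_measurable (coord_filt M s)" by (rule measurable_coord_filt_mono[OF t f])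
  have *: "fork_ratio x x = 1" for x by (simp add: fork_ratio_def)
  show ?thesis
    using fork_nn_integral[OF R Q Q' h h01 h1 order_refl fs] nn_integral_likelihood_ratio[OF R Q fs]
    by (simp only: *) (simp add: algebra_simps)
qed

text \<open>Eliminates likelihood ratios in favour of expectations, with F_s-measurable weights. At
  t = s both descriptions are valid and agree, so the second one may include that time although the
  defining case distinction assigns it to the past.\<close>

lemma fork_combinationE:
  assumes R: "law M R" and Q: "law M Q" "locally_dominated M R Q"
    and Q': "law M Q'" "locally_dominated M R Q'"
    and fc: "fork_combination M R Q Q' Q''"
  obtains s h k where "h \<in> borel_measurable (coord_filt M s)" "k \<in> borel_measurable (coord_filt M s)"
    "\<And>t f. t \<le> s \<Longrightarrow> f \<in> borel_measurable (coord_filt M t) \<Longrightarrow> (\<integral>\<^sup>+\<omega>. f \<omega> \<partial>Q'') = (\<integral>\<^sup>+\<omega>. f \<omega> \<partial>Q)"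
    "\<And>t f. s \<le> t \<Longrightarrow> f \<in> borel_measurable (coord_filt M t) \<Longrightarrow>
      (\<integral>\<^sup>+\<omega>. f \<omega> \<partial>Q'') = (\<integral>\<^sup>+\<omega>. h \<omega> * f \<omega> \<partial>Q) + (\<integral>\<^sup>+\<omega>. k \<omega> * f \<omega> \<partial>Q' :: ennreal)"
proof -
  let ?Z = "likelihood_ratio M R Q" and ?Z' = "likelihood_ratio M R Q'"
  let ?Z'' = "likelihood_ratio M R Q''"
  obtain s h where Q'': "law M Q''" "locally_dominated M R Q''"
    and h: "h \<in> borel_measurable (coord_filt M s)"
    and h01: "\<And>\<omega>. \<omega> \<in> space (seq_space M) \<Longrightarrow> 0 \<le> h \<omega> \<and> h \<omega> \<le> 1"
    and h1: "AE \<omega> in R. ?Z' s \<omega> = 0 \<longrightarrow> h \<omega> = 1"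
    and Z: "\<And>t. AE \<omega> in R. ?Z'' t \<omega> = (if t \<le> s then ?Z t \<omega>
       else h \<omega> * ?Z t \<omega> + (1 - h \<omega>) * ?Z s \<omega> * fork_ratio (?Z' t \<omega>) (?Z' s \<omega>))"
    using fc unfolding fork_combination_def by blast
  have past: "(\<integral>\<^sup>+\<omega>. f \<omega> \<partial>Q'') = (\<integral>\<^sup>+\<omega>. f \<omega> \<partial>Q)"
    if "t \<le> s" "f \<in> borel_measurable (coord_filt M t)" for t f
    unfolding nn_integral_likelihood_ratio[OF R Q that(2)] nn_integral_likelihood_ratio[OF R Q'' that(2)]
    using Z[of t] that(1) by (intro nn_integral_cong_AE) auto
  show ?thesis
  proof (rule that[of "\<lambda>\<omega>. ennreal (h \<omega>)" s "\<lambda>\<omega>. ennreal (fork_weight M R Q Q' s h \<omega>)"])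
    fix t and f :: "(nat \<Rightarrow> 'a) \<Rightarrow> ennreal"
    assume t: "s \<le> t" and f: "f \<in> borel_measurable (coord_filt M t)"
    show "(\<integral>\<^sup>+\<omega>. f \<omega> \<partial>Q'') = (\<integral>\<^sup>+\<omega>. ennreal (h \<omega>) * f \<omega> \<partial>Q)
        + (\<integral>\<^sup>+\<omega>. ennreal (fork_weight M R Q Q' s h \<omega>) * f \<omega> \<partial>Q')"
    proof (cases "t = s")
      case True
      then show ?thesis
        using past[OF _ f] fork_nn_integral_past[OF R Q Q' h h01 h1 _ f] by simp
    next
      case False
      then show ?thesis
        using Z[of t] t
        by (intro trans[OF nn_integral_likelihood_ratio[OF R Q'' f]
          trans[OF _ fork_nn_integral[OF R Q Q' h h01 h1 t f, symmetric]]] nn_integral_cong_AE) auto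
    qed
  qed (use h fork_weight_measurable[OF R h] past in auto)
qed

text \<open>Additivity of integrals follows from additivity on sets by induction over nonnegative
  measurable functions; suprema of increasing sequences commute with the sum.\<close>

lemma measure_sum_exists:
  assumes sets: "sets N = sets M"
  obtains K where "sets K = sets M"
    "\<And>f. f \<in> borel_measurable M \<Longrightarrow> (\<integral>\<^sup>+x. f x \<partial>K) = (\<integral>\<^sup>+x. f x \<partial>M) + (\<integral>\<^sup>+x. f x \<partial>N)"
proof -
  define K where "K = measure_of (space M) (sets M) (\<lambda>A. emeasure M A + emeasure N A)"
  have [simp]: "sets K = sets M" "space K = space M"
    unfolding K_def by (simp_all add: space_measure_of_conv)
  have em: "emeasure K A = emeasure M A + emeasure N A" if "A \<in> sets M" for A
  proof (rule emeasure_measure_of[OF K_def])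
    show "countably_additive (sets K) (\<lambda>A. emeasure M A + emeasure N A)"
      unfolding countably_additive_def
      by (auto simp: sets suminf_add[symmetric] suminf_emeasure summableI)
  qed (use that sets.space_closed in \<open>auto simp: positive_def\<close>)
  have "(\<integral>\<^sup>+x. f x \<partial>K) = (\<integral>\<^sup>+x. f x \<partial>M) + (\<integral>\<^sup>+x. f x \<partial>N)" if "f \<in> borel_measurable M" for f
    using that
  proof (induction rule: borel_measurable_induct)
    case (cong f g)
    have eq: "(\<integral>\<^sup>+x. f x \<partial>K) = (\<integral>\<^sup>+x. g x \<partial>K)" "(\<integral>\<^sup>+x. f x \<partial>M) = (\<integral>\<^sup>+x. g x \<partial>M)"
      "(\<integral>\<^sup>+x. f x \<partial>N) = (\<integral>\<^sup>+x. g x \<partial>N)"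
      using cong(3) sets_eq_imp_space_eq[OF sets] by (auto intro!: nn_integral_cong)
    show ?case unfolding eq by (rule cong(4))
  next
    case (set A)
    then show ?case by (simp add: em sets)
  next
    case (mult u c)
    then have "u \<in> borel_measurable K" "u \<in> borel_measurable N"
      by (auto simp: sets cong: measurable_cong_sets)
    with mult show ?case by (simp add: nn_integral_cmult distrib_left)
  next
    case (add u v)
    then have "u \<in> borel_measurable K" "u \<in> borel_measurable N"
      "v \<in> borel_measurable K" "v \<in> borel_measurable N"
      by (auto simp: sets cong: measurable_cong_sets)
    with add show ?case by (simp add: nn_integral_add)
  next
    case (seq U)
    then have U: "U i \<in> borel_measurable K" "U i \<in> borel_measurable N" "U i \<in> borel_measurable M" for i
      by (auto simp: sets cong: measurable_cong_sets)
    have "(\<integral>\<^sup>+x. (SUP i. U i x) \<partial>K) = (SUP i. (\<integral>\<^sup>+x. U i x \<partial>M) + (\<integral>\<^sup>+x. U i x \<partial>N))"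
      using seq U by (simp add: nn_integral_monotone_convergence_SUP)
    also have "\<dots> = (SUP i. \<integral>\<^sup>+x. U i x \<partial>M) + (SUP i. \<integral>\<^sup>+x. U i x \<partial>N)"
      using seq(3) by (intro ennreal_SUP_add) (auto simp: incseq_def le_fun_def intro!: nn_integral_mono)
    also have "\<dots> = (\<integral>\<^sup>+x. (SUP i. U i x) \<partial>M) + (\<integral>\<^sup>+x. (SUP i. U i x) \<partial>N)"
      using seq U by (simp add: nn_integral_monotone_convergence_SUP)
    finally show ?case by (simp add: SUP_apply[abs_def])
  qed
  then show ?thesis by (intro that[of K]) auto
qed

text \<open>No extension theorem is needed here: the combination is an explicit sum of a measure with
  density \<open>h\<close> under \<open>Q\<close> and one with an \<open>F\<^sub>s\<close>-measurable density under \<open>Q'\<close>.\<close>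

lemma fork_combination_exists:
  assumes R: "law M R" and Q: "law M Q" "locally_dominated M R Q"
    and Q': "law M Q'" "locally_dominated M R Q'"
    and h: "h \<in> borel_measurable (coord_filt M s)"
    and h01: "\<And>\<omega>. \<omega> \<in> space (seq_space M) \<Longrightarrow> 0 \<le> h \<omega> \<and> h \<omega> \<le> 1"
    and h1: "AE \<omega> in R. likelihood_ratio M R Q' s \<omega> = 0 \<longrightarrow> h \<omega> = 1"
  obtains Q'' where "fork_combination M R Q Q' Q''"
    "\<And>f. f \<in> borel_measurable (seq_space M) \<Longrightarrow> (\<integral>\<^sup>+\<omega>. f \<omega> \<partial>Q'') =
      (\<integral>\<^sup>+\<omega>. ennreal (h \<omega>) * f \<omega> \<partial>Q) + (\<integral>\<^sup>+\<omega>. ennreal (fork_weight M R Q Q' s h \<omega>) * f \<omega> \<partial>Q')"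
proof -
  let ?Z = "likelihood_ratio M R Q" and ?Z' = "likelihood_ratio M R Q'"
  let ?k = "fork_weight M R Q Q' s h"
  have hk [measurable]: "h \<in> borel_measurable Q" "?k \<in> borel_measurable Q'"
    using measurable_coord_filt_law[OF Q(1) h] measurable_coord_filt_law[OF Q'(1) fork_weight_measurable[OF R h]]
    by auto
  have sQ: "sets Q = sets (seq_space M)" "sets Q' = sets (seq_space M)"
    using Q(1) Q'(1) by (auto simp: law_def)
  obtain Q'' where s'': "sets Q'' = sets (density Q (\<lambda>\<omega>. ennreal (h \<omega>)))"
    and int: "\<And>f. f \<in> borel_measurable (density Q (\<lambda>\<omega>. ennreal (h \<omega>))) \<Longrightarrow> (\<integral>\<^sup>+\<omega>. f \<omega> \<partial>Q'') =
      (\<integral>\<^sup>+\<omega>. f \<omega> \<partial>density Q (\<lambda>\<omega>. ennreal (h \<omega>))) + (\<integral>\<^sup>+\<omega>. f \<omega> \<partial>density Q' (\<lambda>\<omega>. ennreal (?k \<omega>)))"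
    by (rule measure_sum_exists[of "density Q' (\<lambda>\<omega>. ennreal (?k \<omega>))" "density Q (\<lambda>\<omega>. ennreal (h \<omega>))"])
       (use sQ in auto)
  have int: "(\<integral>\<^sup>+\<omega>. f \<omega> \<partial>Q'') =
      (\<integral>\<^sup>+\<omega>. ennreal (h \<omega>) * f \<omega> \<partial>Q) + (\<integral>\<^sup>+\<omega>. ennreal (?k \<omega>) * f \<omega> \<partial>Q')"
    if f: "f \<in> borel_measurable (seq_space M)" for f
  proof -
    have [measurable]: "f \<in> borel_measurable Q" "f \<in> borel_measurable Q'"
      using f sQ by (simp_all cong: measurable_cong_sets)
    show ?thesis by (subst int) (simp_all add: nn_integral_density)
  qed
  have intF: "f \<in> borel_measurable (seq_space M)" if "f \<in> borel_measurable (coord_filt M t)" for t and f :: "_ \<Rightarrow> ennreal"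
    using that sets_coord_filt_subset[of M t] by (auto simp: measurable_def)
  interpret Q: prob_space Q using Q(1) by (simp add: law_def)
  \<comment> \<open>The mass that the density h takes away from Q is exactly what the weight adds
    under Q': this is the past identity for the function 1.\<close>
  have "emeasure Q'' (space Q'') = (\<integral>\<^sup>+\<omega>. 1 \<partial>Q'')" by simp
  also have "\<dots> = (\<integral>\<^sup>+\<omega>. 1 \<partial>Q)"
    unfolding int[OF borel_measurable_const]
    by (rule fork_nn_integral_past[OF R Q Q' h h01 h1 order_refl borel_measurable_const])
  also have "\<dots> = 1" by (simp add: Q.emeasure_space_1)
  finally have law'': "law M Q''" using s'' sQ by (auto simp: law_def intro: prob_spaceI)
  have ld'': "locally_dominated M R Q''"
    unfolding locally_dominated_def absolutely_continuous_def
  proof (intro allI subsetI)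
    fix t A assume "A \<in> null_sets (restr_to_subalg R (coord_filt M t))"
    then have A: "A \<in> sets (coord_filt M t)"
      and AN: "A \<in> null_sets (restr_to_subalg Q (coord_filt M t))" "A \<in> null_sets (restr_to_subalg Q' (coord_filt M t))"
      using Q(2) Q'(2) R
      by (auto simp: locally_dominated_def absolutely_continuous_def null_sets_restr_to_subalg[OF subalgebra_law[OF R]])
    then have "A \<in> null_sets Q" "A \<in> null_sets Q'"
      by (auto simp: null_sets_restr_to_subalg[OF subalgebra_law[OF Q(1)]]
        null_sets_restr_to_subalg[OF subalgebra_law[OF Q'(1)]])
    then have AE: "AE \<omega> in Q. \<omega> \<notin> A" "AE \<omega> in Q'. \<omega> \<notin> A"
      by (auto intro: AE_not_in)
    have "A \<in> sets (seq_space M)" using A sets_coord_filt_subset[of M t] by auto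
    then have "emeasure Q'' A = (\<integral>\<^sup>+\<omega>. ennreal (h \<omega>) * indicator A \<omega> \<partial>Q) + (\<integral>\<^sup>+\<omega>. ennreal (?k \<omega>) * indicator A \<omega> \<partial>Q')"
      using int[of "indicator A"] s'' sQ by simp
    also have "(\<integral>\<^sup>+\<omega>. ennreal (h \<omega>) * indicator A \<omega> \<partial>Q) = (\<integral>\<^sup>+\<omega>. 0 \<partial>Q)"
      using AE(1) by (intro nn_integral_cong_AE) (auto elim!: eventually_mono)
    also have "(\<integral>\<^sup>+\<omega>. ennreal (?k \<omega>) * indicator A \<omega> \<partial>Q') = (\<integral>\<^sup>+\<omega>. 0 \<partial>Q')"
      using AE(2) by (intro nn_integral_cong_AE) (auto elim!: eventually_mono)
    finally show "A \<in> null_sets (restr_to_subalg Q'' (coord_filt M t))"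
      using A sets_coord_filt_law[OF law'' A]
      unfolding null_sets_restr_to_subalg[OF subalgebra_law[OF law'']] by auto
  qed
  let ?g = "\<lambda>t \<omega>. if t \<le> s then ?Z t \<omega>
       else h \<omega> * ?Z t \<omega> + (1 - h \<omega>) * ?Z s \<omega> * fork_ratio (?Z' t \<omega>) (?Z' s \<omega>)"
  have "AE \<omega> in R. likelihood_ratio M R Q'' t \<omega> = ?g t \<omega>" for t
  proof (rule likelihood_ratio_unique[OF R law''])
    note likelihood_ratio_measurable[OF R, measurable]
    show "?g t \<in> borel_measurable (coord_filt M t)"
    proof (cases "t \<le> s")
      case False
      then have "s \<le> t" by simp
      have [measurable]: "h \<in> borel_measurable (coord_filt M t)"
        "?Z s \<in> borel_measurable (coord_filt M t)" "?Z' s \<in> borel_measurable (coord_filt M t)"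
        using measurable_coord_filt_mono[OF \<open>s \<le> t\<close>] h likelihood_ratio_measurable[OF R] by blast+
      have [measurable]: "(\<lambda>\<omega>. fork_ratio (?Z' t \<omega>) (?Z' s \<omega>)) \<in> borel_measurable (coord_filt M t)"
        unfolding fork_ratio_def by measurable
      show ?thesis using False by simp
    qed simp
    show "0 \<le> ?g t \<omega>" if "\<omega> \<in> space R" for \<omega>
      using h01[of \<omega>] that by (auto simp: space_law[OF R] fork_ratio_def)
    fix A assume A: "A \<in> sets (coord_filt M t)"
    have iA: "(indicator A :: _ \<Rightarrow> ennreal) \<in> borel_measurable (coord_filt M t)"
      using A by simp
    have "emeasure Q'' A = (\<integral>\<^sup>+\<omega>. indicator A \<omega> \<partial>Q'')"
      by (simp add: sets_coord_filt_law[OF law'' A])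
    also have "\<dots> = (\<integral>\<^sup>+\<omega>. ennreal (h \<omega>) * indicator A \<omega> \<partial>Q) + (\<integral>\<^sup>+\<omega>. ennreal (?k \<omega>) * indicator A \<omega> \<partial>Q')"
      by (rule int[OF intF[OF iA]])
    also have "\<dots> = (\<integral>\<^sup>+\<omega>. indicator A \<omega> * ennreal (?g t \<omega>) \<partial>R)"
    proof (cases "t \<le> s")
      case True
      then show ?thesis
        using fork_nn_integral_past[OF R Q Q' h h01 h1 True iA] nn_integral_likelihood_ratio[OF R Q iA]
        by simp
    next
      case False
      then have "s \<le> t" by simp
      with False show ?thesis
        using fork_nn_integral[OF R Q Q' h h01 h1 \<open>s \<le> t\<close> iA] by simp
    qed
    finally show "emeasure Q'' A = (\<integral>\<^sup>+\<omega>. indicator A \<omega> * ennreal (?g t \<omega>) \<partial>R)" .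
  qed
  then have "fork_combination M R Q Q' Q''"
    unfolding fork_combination_def using law'' ld'' h h01 h1 by blast
  with int show ?thesis by (intro that) auto
qed

section \<open>The closed fork-convex hull\<close>

lemma fork_hull_least: "fork_convex M R \<S> \<Longrightarrow> \<Q> \<subseteq> \<S> \<Longrightarrow> fork_hull M R \<Q> \<subseteq> \<S>"
  by (auto simp: fork_hull_def)

lemma subset_fork_hull: "\<Q> \<subseteq> fork_hull M R \<Q>"
  by (auto simp: fork_hull_def)

text \<open>The set of all locally dominated laws is itself fork-convex and contains \<Q>. So the
  intersection is over a nonempty family and consists of locally dominated laws.\<close>

lemma fork_convex_fork_hull:
  assumes "\<And>Q. Q \<in> \<Q> \<Longrightarrow> law M Q \<and> locally_dominated M R Q"
  shows "fork_convex M R (fork_hull M R \<Q>)"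
proof -
  have "fork_convex M R {P. law M P \<and> locally_dominated M R P}"
    by (auto simp: fork_convex_def fork_combination_def)
  then have *: "fork_hull M R \<Q> \<subseteq> {P. law M P \<and> locally_dominated M R P}"
    using assms by (intro fork_hull_least) auto
  show ?thesis unfolding fork_convex_def
  proof (intro conjI ballI allI impI)
    fix Q Q' Q'' assume "Q \<in> fork_hull M R \<Q>" "Q' \<in> fork_hull M R \<Q>" "fork_combination M R Q Q' Q''"
    then show "Q'' \<in> fork_hull M R \<Q>" unfolding fork_hull_def fork_convex_def by blast
  qed (use * in auto)
qed

lemma fork_hull_subset_closed:
  assumes "\<And>Q. Q \<in> \<Q> \<Longrightarrow> law M Q \<and> locally_dominated M R Q"
  shows "fork_hull M R \<Q> \<subseteq> closed_fork_hull M R \<Q>"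
proof
  fix P assume P: "P \<in> fork_hull M R \<Q>"
  then have "law M P \<and> locally_dominated M R P"
    using fork_convex_fork_hull[OF assms] by (auto simp: fork_convex_def)
  with P show "P \<in> closed_fork_hull M R \<Q>"
    by (auto simp: closed_fork_hull_def intro!: exI[of _ "\<lambda>_. P"])
qed

text \<open>Common engine for null sets and supermartingales: an inequality between bounded
  expectations is moved from the limit to the approximating law and back, at the price of one L^1
  distance at time t and one at time s, both tending to 0.\<close>

lemma closed_fork_hull_le:
  assumes R: "law M R" and Q: "\<And>Q. Q \<in> \<Q> \<Longrightarrow> law M Q \<and> locally_dominated M R Q"
    and P: "P \<in> closed_fork_hull M R \<Q>"
    and f: "f \<in> borel_measurable (coord_filt M t)" and fc: "\<And>\<omega>. f \<omega> \<le> ennreal c"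
    and g: "g \<in> borel_measurable (coord_filt M s)" and gc: "\<And>\<omega>. g \<omega> \<le> ennreal c"
    and le: "\<And>Q. Q \<in> fork_hull M R \<Q> \<Longrightarrow> (\<integral>\<^sup>+\<omega>. f \<omega> \<partial>Q) \<le> (\<integral>\<^sup>+\<omega>. g \<omega> \<partial>Q)"
  shows "(\<integral>\<^sup>+\<omega>. f \<omega> \<partial>P) \<le> (\<integral>\<^sup>+\<omega>. g \<omega> \<partial>P)"
proof -
  obtain Pn where Pn: "\<And>n::nat. Pn n \<in> fork_hull M R \<Q>"
    and lim: "\<And>t. (\<lambda>n. \<integral>\<^sup>+\<omega>. ennreal \<bar>likelihood_ratio M R (Pn n) t \<omega> - likelihood_ratio M R P t \<omega>\<bar> \<partial>R) \<longlonglongrightarrow> 0"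
    and P': "law M P" "locally_dominated M R P"
    using P by (auto simp: closed_fork_hull_def)
  define d where "d t n = (\<integral>\<^sup>+\<omega>. ennreal \<bar>likelihood_ratio M R (Pn n) t \<omega> - likelihood_ratio M R P t \<omega>\<bar> \<partial>R)" for t n
  have "(\<integral>\<^sup>+\<omega>. f \<omega> \<partial>P) \<le> (\<integral>\<^sup>+\<omega>. g \<omega> \<partial>P) + ennreal c * d s n + ennreal c * d t n" for n
  proof -
    have Pn': "law M (Pn n)" "locally_dominated M R (Pn n)"
      using Pn fork_convex_fork_hull[OF Q] by (auto simp: fork_convex_def)
    have "(\<integral>\<^sup>+\<omega>. f \<omega> \<partial>P) \<le> (\<integral>\<^sup>+\<omega>. f \<omega> \<partial>Pn n) + ennreal c * d t n"
      using nn_integral_le_likelihood_ratio_dist[OF R P' Pn' f fc] by (simp add: d_def abs_minus_commute)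
    also have "(\<integral>\<^sup>+\<omega>. f \<omega> \<partial>Pn n) \<le> (\<integral>\<^sup>+\<omega>. g \<omega> \<partial>Pn n)" by (rule le[OF Pn])
    also have "(\<integral>\<^sup>+\<omega>. g \<omega> \<partial>Pn n) \<le> (\<integral>\<^sup>+\<omega>. g \<omega> \<partial>P) + ennreal c * d s n"
      using nn_integral_le_likelihood_ratio_dist[OF R Pn' P' g gc] by (simp add: d_def)
    finally show ?thesis by (simp add: add_right_mono)
  qed
  moreover have "(\<lambda>n. (\<integral>\<^sup>+\<omega>. g \<omega> \<partial>P) + ennreal c * d s n + ennreal c * d t n)
      \<longlonglongrightarrow> (\<integral>\<^sup>+\<omega>. g \<omega> \<partial>P) + ennreal c * 0 + ennreal c * 0"
    using lim unfolding d_def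
    by (intro tendsto_add tendsto_const ennreal_tendsto_cmult) auto
  ultimately show ?thesis
    by (intro LIMSEQ_le_const[where a="\<integral>\<^sup>+\<omega>. f \<omega> \<partial>P"]) auto
qed

text \<open>An expectation of 1_A times any weight vanishes under a law for which A is null, so
  neither part of a fork charges A.\<close>

lemma fork_convex_null:
  assumes R: "law M R" and A: "A \<in> sets (coord_filt M t)"
  shows "fork_convex M R {P. law M P \<and> locally_dominated M R P \<and> emeasure P A = 0}"
  unfolding fork_convex_def
proof (intro conjI ballI allI impI)
  fix Q Q' Q'' assume Q: "Q \<in> {P. law M P \<and> locally_dominated M R P \<and> emeasure P A = 0}"
    and Q': "Q' \<in> {P. law M P \<and> locally_dominated M R P \<and> emeasure P A = 0}"
    and fc: "fork_combination M R Q Q' Q''"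
  have law'': "law M Q''" "locally_dominated M R Q''" using fc by (auto simp: fork_combination_def)
  have iA: "indicator A \<in> borel_measurable (coord_filt M t)" using A by simp
  have AP: "A \<in> sets P" if "law M P" for P using sets_coord_filt_law[OF that A] .
  have 0: "(\<integral>\<^sup>+\<omega>. u \<omega> * indicator A \<omega> \<partial>P) = 0" if "law M P" "emeasure P A = 0" for u and P :: "(nat \<Rightarrow> 'a) measure"
  proof -
    have "AE \<omega> in P. \<omega> \<notin> A" using that AP by (intro AE_not_in) (auto simp: null_sets_def)
    then have "(\<integral>\<^sup>+\<omega>. u \<omega> * indicator A \<omega> \<partial>P) = (\<integral>\<^sup>+\<omega>. 0 \<partial>P)"
      by (intro nn_integral_cong_AE) (auto elim!: eventually_mono)
    then show ?thesis by simp
  qed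
  obtain s h k where past: "\<And>t f. t \<le> s \<Longrightarrow> f \<in> borel_measurable (coord_filt M t) \<Longrightarrow> (\<integral>\<^sup>+\<omega>. f \<omega> \<partial>Q'') = (\<integral>\<^sup>+\<omega>. f \<omega> \<partial>Q)"
    and future: "\<And>t f. s \<le> t \<Longrightarrow> f \<in> borel_measurable (coord_filt M t) \<Longrightarrow>
      (\<integral>\<^sup>+\<omega>. f \<omega> \<partial>Q'') = (\<integral>\<^sup>+\<omega>. h \<omega> * f \<omega> \<partial>Q) + (\<integral>\<^sup>+\<omega>. k \<omega> * f \<omega> \<partial>Q' :: ennreal)"
    by (rule fork_combinationE[OF R _ _ _ _ fc, of thesis]) (use Q Q' in blast)+
  have "(\<integral>\<^sup>+\<omega>. indicator A \<omega> \<partial>Q'') = 0"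
  proof (cases "t \<le> s")
    case True
    then show ?thesis using past[OF True iA] 0[of Q "\<lambda>_. 1"] Q by simp
  next
    case False
    then show ?thesis using future[OF _ iA] 0[of Q h] 0[of Q' k] Q Q' by simp
  qed
  then show "Q'' \<in> {P. law M P \<and> locally_dominated M R P \<and> emeasure P A = 0}"
    using law'' AP by auto
qed auto

text \<open>Carries almost sure domination from \<Q> to the closed hull; A will be the event {L_t <
  E_t}.\<close>

lemma closed_fork_hull_null:
  assumes R: "law M R" and Q: "\<And>Q. Q \<in> \<Q> \<Longrightarrow> law M Q \<and> locally_dominated M R Q"
    and A: "A \<in> sets (coord_filt M t)" and 0: "\<And>Q. Q \<in> \<Q> \<Longrightarrow> emeasure Q A = 0"
    and P: "P \<in> closed_fork_hull M R \<Q>"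
  shows "emeasure P A = 0"
proof -
  have "fork_hull M R \<Q> \<subseteq> {P. law M P \<and> locally_dominated M R P \<and> emeasure P A = 0}"
    using Q 0 by (intro fork_hull_least fork_convex_null[OF R A]) auto
  then have "(\<integral>\<^sup>+\<omega>. indicator A \<omega> \<partial>Q) \<le> (\<integral>\<^sup>+\<omega>. 0 \<partial>Q)" if "Q \<in> fork_hull M R \<Q>" for Q
    using that sets_coord_filt_law[OF _ A] by auto
  then have "(\<integral>\<^sup>+\<omega>. indicator A \<omega> \<partial>P) \<le> (\<integral>\<^sup>+\<omega>. 0 \<partial>P)"
    using A by (intro closed_fork_hull_le[OF R Q P, where c=1 and s=0 and t=t])
      (auto simp: indicator_def)
  moreover have "A \<in> sets P" using P sets_coord_filt_law[OF _ A] by (auto simp: closed_fork_hull_def)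
  ultimately show ?thesis by simp
qed

text \<open>A single step from t to t + 1 never straddles the switching time s: either both times
  lie in the past, where the law is Q, or both lie in the future, where the weights h and k join the
  test function.\<close>

lemma fork_convex_nn_supermartingale:
  assumes R: "law M R" and L: "\<And>t. L t \<in> borel_measurable (coord_filt M t)"
  shows "fork_convex M R {P. law M P \<and> locally_dominated M R P \<and> nn_supermartingale M P L}"
  unfolding fork_convex_def
proof (intro conjI ballI allI impI)
  fix Q Q' Q''
  assume "Q \<in> {P. law M P \<and> locally_dominated M R P \<and> nn_supermartingale M P L}"
    and "Q' \<in> {P. law M P \<and> locally_dominated M R P \<and> nn_supermartingale M P L}"
    and fc: "fork_combination M R Q Q' Q''"
  then have Q: "law M Q" "locally_dominated M R Q" "nn_supermartingale M Q L"
    and Q': "law M Q'" "locally_dominated M R Q'" "nn_supermartingale M Q' L" by auto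
  obtain s h k where hk: "h \<in> borel_measurable (coord_filt M s)" "k \<in> borel_measurable (coord_filt M s)"
    and past: "\<And>t f. t \<le> s \<Longrightarrow> f \<in> borel_measurable (coord_filt M t) \<Longrightarrow> (\<integral>\<^sup>+\<omega>. f \<omega> \<partial>Q'') = (\<integral>\<^sup>+\<omega>. f \<omega> \<partial>Q)"
    and future: "\<And>t f. s \<le> t \<Longrightarrow> f \<in> borel_measurable (coord_filt M t) \<Longrightarrow>
      (\<integral>\<^sup>+\<omega>. f \<omega> \<partial>Q'') = (\<integral>\<^sup>+\<omega>. h \<omega> * f \<omega> \<partial>Q) + (\<integral>\<^sup>+\<omega>. k \<omega> * f \<omega> \<partial>Q' :: ennreal)"
    by (rule fork_combinationE[OF R Q(1,2) Q'(1,2) fc]) blast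
  have "nn_supermartingale M Q'' L"
  proof (rule nn_supermartingale_SucI)
    fix t and g :: "(nat \<Rightarrow> 'a) \<Rightarrow> ennreal" assume g [measurable]: "g \<in> borel_measurable (coord_filt M t)"
    have gs: "g \<in> borel_measurable (coord_filt M (Suc t))"
      by (rule measurable_coord_filt_mono[OF _ g]) simp
    have m: "(\<lambda>\<omega>. g \<omega> * L t \<omega>) \<in> borel_measurable (coord_filt M t)"
      "(\<lambda>\<omega>. g \<omega> * L (Suc t) \<omega>) \<in> borel_measurable (coord_filt M (Suc t))"
      using L[of t] L[of "Suc t"] g gs by auto
    show "(\<integral>\<^sup>+\<omega>. g \<omega> * L (Suc t) \<omega> \<partial>Q'') \<le> (\<integral>\<^sup>+\<omega>. g \<omega> * L t \<omega> \<partial>Q'')"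
    proof (cases "s \<le> t")
      case False
      then show ?thesis
        using past[OF _ m(1)] past[OF _ m(2)] nn_supermartingaleD[OF Q(3) _ g, of "Suc t"] by simp
    next
      case True
      have hkt: "(\<lambda>\<omega>. h \<omega> * g \<omega>) \<in> borel_measurable (coord_filt M t)"
        "(\<lambda>\<omega>. k \<omega> * g \<omega>) \<in> borel_measurable (coord_filt M t)"
        using measurable_coord_filt_mono[OF True hk(1)] measurable_coord_filt_mono[OF True hk(2)] g by auto
      have "(\<integral>\<^sup>+\<omega>. g \<omega> * L (Suc t) \<omega> \<partial>Q'')
        = (\<integral>\<^sup>+\<omega>. h \<omega> * g \<omega> * L (Suc t) \<omega> \<partial>Q) + (\<integral>\<^sup>+\<omega>. k \<omega> * g \<omega> * L (Suc t) \<omega> \<partial>Q')"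
        using future[OF _ m(2)] True by (simp add: mult.assoc)
      also have "\<dots> \<le> (\<integral>\<^sup>+\<omega>. h \<omega> * g \<omega> * L t \<omega> \<partial>Q) + (\<integral>\<^sup>+\<omega>. k \<omega> * g \<omega> * L t \<omega> \<partial>Q')"
        by (intro add_mono nn_supermartingaleD[OF Q(3) _ hkt(1)] nn_supermartingaleD[OF Q'(3) _ hkt(2)]) auto
      also have "\<dots> = (\<integral>\<^sup>+\<omega>. g \<omega> * L t \<omega> \<partial>Q'')"
        using future[OF _ m(1)] True by (simp add: mult.assoc)
      finally show ?thesis .
    qed
  qed
  then show "Q'' \<in> {P. law M P \<and> locally_dominated M R P \<and> nn_supermartingale M P L}"
    using fc by (auto simp: fork_combination_def)
qed auto

text \<open>Convergence of likelihood ratios passes to the limit only for bounded integrands,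
  hence the truncation at level \<open>k\<close> of both sides of the supermartingale inequality.\<close>

lemma closed_fork_hull_nn_supermartingale:
  fixes L :: "nat \<Rightarrow> (nat \<Rightarrow> 'a) \<Rightarrow> real"
  assumes R: "law M R" and Q: "\<And>Q. Q \<in> \<Q> \<Longrightarrow> law M Q \<and> locally_dominated M R Q"
    and L: "nonneg_adapted M L"
    and sm: "\<And>Q. Q \<in> \<Q> \<Longrightarrow> nn_supermartingale M Q (\<lambda>t \<omega>. ennreal (L t \<omega>))"
    and P: "P \<in> closed_fork_hull M R \<Q>"
  shows "nn_supermartingale M P (\<lambda>t \<omega>. ennreal (L t \<omega>))"
  unfolding nn_supermartingale_def
proof (intro allI impI)
  fix s t :: nat and g :: "(nat \<Rightarrow> 'a) \<Rightarrow> ennreal"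
  assume st: "s \<le> t" and g: "g \<in> borel_measurable (coord_filt M s)"
  have LF: "L t \<in> borel_measurable (coord_filt M t)" for t
    using L by (simp add: nonneg_adapted_def)
  have LF': "(\<lambda>\<omega>. ennreal (L t \<omega>)) \<in> borel_measurable (coord_filt M t)" for t
    by (rule measurable_compose[OF LF measurable_ennreal])
  have lawP: "law M P" using P by (simp add: closed_fork_hull_def)
  have hull: "nn_supermartingale M Q' (\<lambda>t \<omega>. ennreal (L t \<omega>))" if "Q' \<in> fork_hull M R \<Q>" for Q'
    using fork_hull_least[OF fork_convex_nn_supermartingale[OF R LF'], of \<Q>] Q sm that by auto
  \<comment> \<open>Only quantities known at time s are cut here, so \<open>u k\<close> is still an
    admissible test function. The cut L_t \<le> k, unknown at time s, is placed in
    \<open>f k\<close> on the smaller side, where it can only help. All integrands are then bounded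
    by k * k.\<close>
  define u where "u k \<omega> = min (g \<omega>) (of_nat k) * indicator {\<omega>. L s \<omega> \<le> real k} \<omega>" for k :: nat and \<omega>
  define f where "f k \<omega> = u k \<omega> * (indicator {\<omega>. L t \<omega> \<le> real k} \<omega> * ennreal (L t \<omega>))" for k \<omega>
  have ind: "(\<lambda>\<omega>. indicator {\<omega>. L t \<omega> \<le> real k} \<omega> :: ennreal) \<in> borel_measurable (coord_filt M t)" for t k
    unfolding indicator_def using LF[of t] by simp
  have u: "u k \<in> borel_measurable (coord_filt M s)" for k
    unfolding u_def using g ind[of s k] by simp
  have uL: "(\<lambda>\<omega>. u k \<omega> * ennreal (L s \<omega>)) \<in> borel_measurable (coord_filt M s)" for k
    using u LF'[of s] by simp
  have f: "f k \<in> borel_measurable (coord_filt M t)" for k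
    unfolding f_def using measurable_coord_filt_mono[OF st u, of k] ind[of t k] LF'[of t] by simp
  have uk: "u k \<omega> \<le> of_nat k" for k \<omega> by (auto simp: u_def indicator_def)
  have "ennreal (L t \<omega>) * indicator {\<omega>. L t \<omega> \<le> real k} \<omega> \<le> of_nat k" for t k \<omega>
    by (auto simp: indicator_def ennreal_of_nat_eq_real_of_nat intro!: ennreal_leI)
  note Lk = this
  have sq: "of_nat k * of_nat k = ennreal (real k * real k)" for k
    by (simp add: ennreal_of_nat_eq_real_of_nat ennreal_mult)
  have fk: "f k \<omega> \<le> ennreal (real k * real k)" for k \<omega>
    unfolding f_def sq[symmetric] using uk[of k \<omega>] Lk[of t \<omega> k] by (intro mult_mono) (auto simp: mult.commute)
  have uLk: "u k \<omega> * ennreal (L s \<omega>) \<le> ennreal (real k * real k)" for k \<omega>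
  proof -
    have "u k \<omega> * ennreal (L s \<omega>) \<le> of_nat k * (ennreal (L s \<omega>) * indicator {\<omega>. L s \<omega> \<le> real k} \<omega>)"
      unfolding u_def by (auto simp: indicator_def intro!: mult_right_mono)
    also have "\<dots> \<le> of_nat k * of_nat k" by (intro mult_left_mono Lk) auto
    finally show ?thesis by (simp add: sq)
  qed
  have le: "(\<integral>\<^sup>+\<omega>. f k \<omega> \<partial>P) \<le> (\<integral>\<^sup>+\<omega>. g \<omega> * ennreal (L s \<omega>) \<partial>P)" for k
  proof -
    have "(\<integral>\<^sup>+\<omega>. f k \<omega> \<partial>P) \<le> (\<integral>\<^sup>+\<omega>. u k \<omega> * ennreal (L s \<omega>) \<partial>P)"
    proof (rule closed_fork_hull_le[OF R Q P f fk uL uLk])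
      fix Q' assume "Q' \<in> fork_hull M R \<Q>"
      have "(\<integral>\<^sup>+\<omega>. f k \<omega> \<partial>Q') \<le> (\<integral>\<^sup>+\<omega>. u k \<omega> * ennreal (L t \<omega>) \<partial>Q')"
        by (intro nn_integral_mono) (auto simp: f_def indicator_def)
      also have "\<dots> \<le> (\<integral>\<^sup>+\<omega>. u k \<omega> * ennreal (L s \<omega>) \<partial>Q')"
        by (rule nn_supermartingaleD[OF hull[OF \<open>Q' \<in> _\<close>] st u])
      finally show "(\<integral>\<^sup>+\<omega>. f k \<omega> \<partial>Q') \<le> (\<integral>\<^sup>+\<omega>. u k \<omega> * ennreal (L s \<omega>) \<partial>Q')" .
    qed
    also have "\<dots> \<le> (\<integral>\<^sup>+\<omega>. g \<omega> * ennreal (L s \<omega>) \<partial>P)"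
      by (intro nn_integral_mono mult_right_mono) (auto simp: u_def indicator_def)
    finally show ?thesis .
  qed
  have mono: "incseq f"
    unfolding f_def u_def incseq_def le_fun_def
    by (auto simp: indicator_def intro!: mult_right_mono min.mono of_nat_mono)
  have "(\<integral>\<^sup>+\<omega>. g \<omega> * ennreal (L t \<omega>) \<partial>P) \<le> (\<integral>\<^sup>+\<omega>. (SUP k. f k \<omega>) \<partial>P)"
  proof (rule nn_integral_mono)
    fix \<omega>
    \<comment> \<open>From index K on neither indicator cuts at this point, and only the truncation
      of g remains.\<close>
    obtain K where K: "L s \<omega> \<le> real K" "L t \<omega> \<le> real K"
      using real_arch_simple[of "max (L s \<omega>) (L t \<omega>)"] by auto
    have "g \<omega> = inf (g \<omega>) (SUP k. of_nat k)" by (simp add: ennreal_SUP_of_nat_eq_top)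
    also have "\<dots> = (SUP k. min (g \<omega>) (of_nat k))" by (simp add: inf_SUP flip: inf_min)
    finally have "g \<omega> * ennreal (L t \<omega>) = (SUP k. min (g \<omega>) (of_nat k)) * ennreal (L t \<omega>)" by simp
    also have "\<dots> = (SUP k. min (g \<omega>) (of_nat k) * ennreal (L t \<omega>))"
      by (rule SUP_mult_right_ennreal)
    also have "\<dots> \<le> (SUP k. f k \<omega>)"
    proof (rule SUP_least)
      fix k
      have "min (g \<omega>) (of_nat k) * ennreal (L t \<omega>) \<le> f (max k K) \<omega>"
        using K by (auto simp: f_def u_def indicator_def le_max_iff_disj intro!: mult_right_mono min.mono of_nat_mono)
      then show "min (g \<omega>) (of_nat k) * ennreal (L t \<omega>) \<le> (SUP k. f k \<omega>)"
        by (intro SUP_upper2[of "max k K"]) auto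
    qed
    finally show "g \<omega> * ennreal (L t \<omega>) \<le> (SUP k. f k \<omega>)" .
  qed
  also have "\<dots> = (SUP k. \<integral>\<^sup>+\<omega>. f k \<omega> \<partial>P)"
    by (intro nn_integral_monotone_convergence_SUP mono measurable_coord_filt_law[OF lawP f])
  also have "\<dots> \<le> (\<integral>\<^sup>+\<omega>. g \<omega> * ennreal (L s \<omega>) \<partial>P)" by (intro SUP_least le)
  finally show "(\<integral>\<^sup>+\<omega>. g \<omega> * ennreal (L t \<omega>) \<partial>P) \<le> (\<integral>\<^sup>+\<omega>. g \<omega> * ennreal (L s \<omega>) \<partial>P)" .
qed

section \<open>Essential suprema\<close>

text \<open>The map x to 1 / (1 + x) is a strict order reversal of [0, \<infinity>] into [0, 1].
  Minimising its integral replaces maximising the integral of a supremum that may be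
  infinite.\<close>

lemma ennreal_inverse_one_plus_le_iff:
  fixes a b :: ennreal
  shows "inverse (1 + a) \<le> inverse (1 + b) \<longleftrightarrow> b \<le> a"
proof -
  have *: "inverse (1 + ennreal z) = ennreal (inverse (1 + z))" if "0 \<le> z" for z
    using that by (simp add: inverse_ennreal flip: ennreal_1 ennreal_plus)
  show ?thesis
    by (cases a rule: ennreal_cases; cases b rule: ennreal_cases)
       (auto simp: * top_unique)
qed

text \<open>The countable subfamily is chosen to minimize the integral of \<open>1 / (1 + sup)\<close>.\<close>

lemma countable_essential_supremum:
  fixes Y :: "('b \<Rightarrow> ennreal) set"
  assumes "finite_measure N" and Y: "Y \<subseteq> borel_measurable N"
  obtains y :: "nat \<Rightarrow> 'b \<Rightarrow> ennreal" where "range y \<subseteq> insert (\<lambda>_. 0) Y"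
    "\<And>f. f \<in> Y \<Longrightarrow> AE x in N. f x \<le> (SUP i. y i x)"
proof -
  interpret finite_measure N by fact
  \<comment> \<open>The zero function is adjoined so that sequences exist even for empty Y.\<close>
  define S where "S = {y :: nat \<Rightarrow> 'b \<Rightarrow> ennreal. range y \<subseteq> insert (\<lambda>_. 0) Y}"
  define I where "I y = (\<integral>\<^sup>+x. inverse (1 + (SUP i. y i x)) \<partial>N)" for y :: "nat \<Rightarrow> 'b \<Rightarrow> ennreal"
  have meas: "(\<lambda>x. inverse (1 + (SUP i. y i x))) \<in> borel_measurable N" if "y \<in> S" for y
  proof -
    have "y i \<in> insert (\<lambda>_. 0) Y" for i using that by (auto simp: S_def)
    then have [measurable]: "y i \<in> borel_measurable N" for i using Y by (metis borel_measurable_const insertE subsetD)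
    show ?thesis by simp
  qed
  have "(\<lambda>_ _. 0) \<in> S" by (auto simp: S_def)
  then have "I ` S \<noteq> {}" by auto
  from ennreal_Inf_countable_INF[OF this] obtain m :: "nat \<Rightarrow> ennreal" where m: "range m \<subseteq> I ` S" "Inf (I ` S) = (INF i. m i)" by blast
  have "m i \<in> I ` S" for i using m(1) by (rule subsetD) simp
  then have "\<forall>i. \<exists>y. y \<in> S \<and> m i = I y" by (simp only: image_iff Bex_def) blast
  from choice[OF this] obtain yn where yn: "\<And>i. yn i \<in> S" "\<And>i. m i = I (yn i)" by blast
  \<comment> \<open>A pairing function merges a minimising sequence of sequences into one. Its
    supremum dominates each of theirs, so the infimum of \<open>I\<close> is attained at y.\<close>
  define y where "y n = yn (fst (prod_decode n)) (snd (prod_decode n))" for n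
  have yS: "y \<in> S" using yn(1) by (auto simp: S_def y_def)
  have le: "yn i j x \<le> (SUP n. y n x)" for i j x
    by (rule SUP_upper2[of "prod_encode (i, j)"]) (auto simp: y_def)
  have "I y \<le> m i" for i
    unfolding yn(2) I_def
    by (intro nn_integral_mono ennreal_inverse_one_plus_le_iff[THEN iffD2] SUP_least le)
  then have Iy: "I y \<le> I y'" if "y' \<in> S" for y'
    using that m(2) by (metis INF_greatest INF_lower order_trans)
  show ?thesis
  proof (rule that[of y])
    show "range y \<subseteq> insert (\<lambda>_. 0) Y" using yS by (auto simp: S_def)
    fix f assume f: "f \<in> Y"
    \<comment> \<open>If f exceeded the supremum on a set of positive measure, prepending f would
      lower \<open>I\<close> below its minimum.\<close>
    define y' where "y' n = (case n of 0 \<Rightarrow> f | Suc n \<Rightarrow> y n)" for n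
    have yS': "y' \<in> S" using yS f by (auto simp: S_def y'_def image_subset_iff split: nat.splits)
    have le: "y n x \<le> (SUP n. y' n x)" for n x
      by (rule SUP_upper2[of "Suc n"]) (auto simp: y'_def)
    let ?u = "\<lambda>x. inverse (1 + (SUP i. y i x))" and ?u' = "\<lambda>x. inverse (1 + (SUP i. y' i x))"
    have "?u' x \<le> 1" for x
    proof -
      have "?u' x \<le> inverse (1 + 0)" by (subst ennreal_inverse_one_plus_le_iff) simp
      then show ?thesis by simp
    qed
    then have "(\<integral>\<^sup>+x. ?u' x \<partial>N) \<le> (\<integral>\<^sup>+x. 1 \<partial>N)" by (intro nn_integral_mono)
    also have "\<dots> < \<infinity>" by (simp add: less_top[symmetric] emeasure_finite)
    finally have fin: "(\<integral>\<^sup>+x. ?u' x \<partial>N) \<noteq> \<infinity>" by simp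
    have "(\<integral>\<^sup>+x. ?u x - ?u' x \<partial>N) = I y - I y'"
      unfolding I_def using fin
      by (intro nn_integral_diff meas yS yS')
         (auto intro!: ennreal_inverse_one_plus_le_iff[THEN iffD2] SUP_least le)
    also have "\<dots> = 0" using Iy[OF yS'] fin by (simp add: diff_eq_0_iff_ennreal I_def less_top)
    finally have "AE x in N. ?u x - ?u' x = 0"
      using meas[OF yS] meas[OF yS'] by (subst (asm) nn_integral_0_iff_AE) auto
    then show "AE x in N. f x \<le> (SUP i. y i x)"
    proof eventually_elim
      case (elim x)
      have "?u x \<noteq> top" by (simp add: ennreal_inverse_eq_top_iff)
      with elim have "?u x \<le> ?u' x" by (simp add: diff_eq_0_iff_ennreal less_top)
      then have "(SUP i. y' i x) \<le> (SUP i. y i x)" by (simp only: ennreal_inverse_one_plus_le_iff)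
      moreover have "f x \<le> (SUP i. y' i x)" by (rule SUP_upper2[of 0]) (auto simp: y'_def)
      ultimately show ?case by simp
    qed
  qed
qed

section \<open>The Snell envelope over a fork-convex set\<close>

text \<open>The choice between the two times depends on B, which is known at t, and both times wait
  until t. Before t the event of having stopped is empty; from t on B is available.\<close>

lemma stopping_time_paste:
  assumes \<tau>: "seq_stopping_time M \<tau>" "seq_stopping_time M \<tau>'" and B: "B \<in> sets (coord_filt M t)"
    and ge: "\<And>\<omega>. \<omega> \<in> space (seq_space M) \<Longrightarrow> enat t \<le> \<tau> \<omega>" "\<And>\<omega>. \<omega> \<in> space (seq_space M) \<Longrightarrow> enat t \<le> \<tau>' \<omega>"
  shows "seq_stopping_time M (\<lambda>\<omega>. if \<omega> \<in> B then \<tau>' \<omega> else \<tau> \<omega>)"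
  unfolding seq_stopping_time_def
proof (rule stopping_timeI)
  fix u :: enat
  show "Measurable.pred (case u of enat n \<Rightarrow> coord_filt M n | \<infinity> \<Rightarrow> seq_space M)
      (\<lambda>\<omega>. (if \<omega> \<in> B then \<tau>' \<omega> else \<tau> \<omega>) \<le> u)"
  proof (cases u)
    case (enat n)
    show ?thesis
    proof (cases "t \<le> n")
      case True
      have "B \<in> sets (coord_filt M n)" using sets_coord_filt_mono[OF True] B by blast
      moreover have "{\<omega>\<in>space (coord_filt M n). \<tau> \<omega> \<le> enat n} \<in> sets (coord_filt M n)"
        "{\<omega>\<in>space (coord_filt M n). \<tau>' \<omega> \<le> enat n} \<in> sets (coord_filt M n)"
        using seq_stopping_time_pred[OF \<tau>(1), of n] seq_stopping_time_pred[OF \<tau>(2), of n] by (simp_all add: pred_def)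
      ultimately have "B \<inter> {\<omega>\<in>space (coord_filt M n). \<tau>' \<omega> \<le> enat n}
          \<union> ({\<omega>\<in>space (coord_filt M n). \<tau> \<omega> \<le> enat n} - B) \<in> sets (coord_filt M n)" by blast
      also have "B \<inter> {\<omega>\<in>space (coord_filt M n). \<tau>' \<omega> \<le> enat n}
          \<union> ({\<omega>\<in>space (coord_filt M n). \<tau> \<omega> \<le> enat n} - B)
        = {\<omega>\<in>space (coord_filt M n). (if \<omega> \<in> B then \<tau>' \<omega> else \<tau> \<omega>) \<le> enat n}" by auto
      finally show ?thesis by (simp add: enat pred_def)
    next
      case False
      then have "\<not> (if \<omega> \<in> B then \<tau>' \<omega> else \<tau> \<omega>) \<le> enat n" if "\<omega> \<in> space (seq_space M)" for \<omega>
        using ge[OF that] by (auto dest: order_trans)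
      then have "{\<omega>\<in>space (coord_filt M n). (if \<omega> \<in> B then \<tau>' \<omega> else \<tau> \<omega>) \<le> enat n} = {}" by auto
      then show ?thesis by (simp only: enat pred_def enat.case sets.empty_sets)
    qed
  qed simp
qed

lemma seq_stopping_time_const: "seq_stopping_time M (\<lambda>_. c)"
  unfolding seq_stopping_time_def by (rule stopping_time_const)

locale fork_convex_family =
  fixes M :: "'a measure" and R :: "(nat \<Rightarrow> 'a) measure" and H :: "(nat \<Rightarrow> 'a) measure set"
    and E :: "nat \<Rightarrow> (nat \<Rightarrow> 'a) \<Rightarrow> real"
  assumes law_R: "law M R" and fork_convex_H: "fork_convex M R H" and adapted: "nonneg_adapted M E"
begin

abbreviation "F \<equiv> coord_filt M"
abbreviation "Z \<equiv> likelihood_ratio M R"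

lemma law_H: "Q \<in> H \<Longrightarrow> law M Q" and dominated_H: "Q \<in> H \<Longrightarrow> locally_dominated M R Q"
  using fork_convex_H by (auto simp: fork_convex_def)

text \<open>Law and stopping time are varied jointly, since a switch changes both. The law need not
  agree with the current one up to t: only its conditional behaviour after t will be used.\<close>

definition continuations :: "nat \<Rightarrow> ((nat \<Rightarrow> 'a) measure \<times> ((nat \<Rightarrow> 'a) \<Rightarrow> enat)) set" where
  "continuations t = {(Q, \<tau>). Q \<in> H \<and> seq_stopping_time M \<tau> \<and> (\<forall>\<omega>\<in>space (seq_space M). enat t \<le> \<tau> \<omega>)}"

text \<open>The conditional expectation is an arbitrary version where the likelihood ratio vanishes;
  it is set to \<open>0\<close> there so that it can be compared across laws up to \<open>R\<close>-null sets.\<close>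

definition reward :: "nat \<Rightarrow> (nat \<Rightarrow> 'a) measure \<times> ((nat \<Rightarrow> 'a) \<Rightarrow> enat) \<Rightarrow> (nat \<Rightarrow> 'a) \<Rightarrow> ennreal" where
  "reward t = (\<lambda>(Q, \<tau>) \<omega>. nn_cond_exp Q (F t) (stopped E \<tau>) \<omega> * indicator {\<omega>. 0 < Z Q t \<omega>} \<omega>)"

lemma reward_measurable: "reward t c \<in> borel_measurable (F t)"
proof -
  note likelihood_ratio_measurable[OF law_R, measurable]
  have "(\<lambda>\<omega>. indicator {\<omega>. 0 < Z Q t \<omega>} \<omega> :: ennreal) \<in> borel_measurable (F t)" for Q
    unfolding indicator_def by measurable
  then show ?thesis
    unfolding reward_def by (cases c) (simp add: borel_measurable_nn_cond_exp)
qed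

lemma stopped_measurable_H:
  "(Q, \<tau>) \<in> continuations t \<Longrightarrow> Q' \<in> H \<Longrightarrow> stopped E \<tau> \<in> borel_measurable Q'"
  by (intro stopped_measurable[OF _ _ adapted] law_H) (auto simp: continuations_def)

text \<open>The defining identity of conditional expectation survives the cut at {Z_t = 0}, a null
  event under the law that performs the conditioning.\<close>

lemma nn_integral_reward:
  assumes c: "(Q, \<tau>) \<in> continuations t" and g: "g \<in> borel_measurable (F t)"
  shows "(\<integral>\<^sup>+\<omega>. g \<omega> * reward t (Q, \<tau>) \<omega> \<partial>Q) = (\<integral>\<^sup>+\<omega>. g \<omega> * stopped E \<tau> \<omega> \<partial>Q)"
proof -
  have Q: "Q \<in> H" using c by (simp add: continuations_def)
  interpret sigma_finite_subalgebra Q "F t" by (rule sigma_finite_subalgebra_law[OF law_H[OF Q]])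
  have "(\<integral>\<^sup>+\<omega>. g \<omega> * reward t (Q, \<tau>) \<omega> \<partial>Q) = (\<integral>\<^sup>+\<omega>. g \<omega> * nn_cond_exp Q (F t) (stopped E \<tau>) \<omega> \<partial>Q)"
    using AE_likelihood_ratio_pos[OF law_R law_H[OF Q] dominated_H[OF Q], of t]
    by (intro nn_integral_cong_AE) (auto simp: reward_def elim!: eventually_mono)
  also have "\<dots> = (\<integral>\<^sup>+\<omega>. g \<omega> * stopped E \<tau> \<omega> \<partial>Q)"
    by (rule nn_cond_exp_intg[OF g stopped_measurable_H[OF c Q]])
  finally show ?thesis .
qed

text \<open>Two continuations at time \<open>t\<close> are pasted by following, on each half of an \<open>F\<^sub>t\<close>-measurable
  partition, the one with the larger reward; that the pasted law stays in \<open>H\<close> is fork-convexity.\<close>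

lemma paste_continuations:
  assumes c: "(Q, \<tau>) \<in> continuations t" and c': "(Q', \<tau>') \<in> continuations t"
  obtains Q'' \<tau>'' where "(Q'', \<tau>'') \<in> continuations t"
    "\<And>f. f \<in> borel_measurable (F t) \<Longrightarrow> (\<integral>\<^sup>+\<omega>. f \<omega> \<partial>Q'') = (\<integral>\<^sup>+\<omega>. f \<omega> \<partial>Q)"
    "\<And>g. g \<in> borel_measurable (F t) \<Longrightarrow>
      (\<integral>\<^sup>+\<omega>. g \<omega> * max (reward t (Q, \<tau>) \<omega>) (reward t (Q', \<tau>') \<omega>) \<partial>Q)
        = (\<integral>\<^sup>+\<omega>. g \<omega> * stopped E \<tau>'' \<omega> \<partial>Q'')"
proof -
  have Q: "Q \<in> H" and Q': "Q' \<in> H" using c c' by (auto simp: continuations_def)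
  note lawQ = law_H[OF Q] dominated_H[OF Q] and lawQ' = law_H[OF Q'] dominated_H[OF Q']
  let ?Y = "reward t (Q, \<tau>)" and ?Y' = "reward t (Q', \<tau>')"
  note Y [measurable] = reward_measurable[of t "(Q, \<tau>)"] and Y' [measurable] = reward_measurable[of t "(Q', \<tau>')"]
  \<comment> \<open>The strict inequality matters: on B the second reward is positive, hence Z'_t >
    0, so h = 1 on {Z'_t = 0} holds at every point.\<close>
  define B where "B = {\<omega>\<in>space (F t). ?Y \<omega> < ?Y' \<omega>}"
  have B [measurable]: "B \<in> sets (F t)" unfolding B_def by measurable
  define h where "h \<omega> = (1 - indicator B \<omega> :: real)" for \<omega>
  have h: "h \<in> borel_measurable (F t)" unfolding h_def by measurable
  have h01: "0 \<le> h \<omega> \<and> h \<omega> \<le> 1" for \<omega> by (auto simp: h_def indicator_def)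
  have h1: "Z Q' t \<omega> = 0 \<longrightarrow> h \<omega> = 1" for \<omega> by (auto simp: h_def B_def reward_def indicator_def)
  obtain Q'' where fc: "fork_combination M R Q Q' Q''"
    and int: "\<And>f. f \<in> borel_measurable (seq_space M) \<Longrightarrow> (\<integral>\<^sup>+\<omega>. f \<omega> \<partial>Q'') =
      (\<integral>\<^sup>+\<omega>. ennreal (h \<omega>) * f \<omega> \<partial>Q) + (\<integral>\<^sup>+\<omega>. ennreal (fork_weight M R Q Q' t h \<omega>) * f \<omega> \<partial>Q')"
    by (rule fork_combination_exists[OF law_R lawQ lawQ' h]) (use h01 h1 in auto)
  let ?k = "fork_weight M R Q Q' t h"
  have k: "?k \<in> borel_measurable (F t)" by (rule fork_weight_measurable[OF law_R h])
  have Q'': "Q'' \<in> H" using fork_convex_H Q Q' fc unfolding fork_convex_def by blast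
  define \<tau>'' where "\<tau>'' \<omega> = (if \<omega> \<in> B then \<tau>' \<omega> else \<tau> \<omega>)" for \<omega>
  have c'': "(Q'', \<tau>'') \<in> continuations t"
    unfolding continuations_def \<tau>''_def using Q'' c c' B
    by (auto simp: continuations_def intro!: stopping_time_paste)
  have seq: "f \<in> borel_measurable (seq_space M)" if "f \<in> borel_measurable (F t)" for f :: "_ \<Rightarrow> ennreal"
    using that sets_coord_filt_subset[of M t] by (auto simp: measurable_def)
  have past: "(\<integral>\<^sup>+\<omega>. f \<omega> \<partial>Q'') = (\<integral>\<^sup>+\<omega>. f \<omega> \<partial>Q)" if "f \<in> borel_measurable (F t)" for f
    unfolding int[OF seq[OF that]]
    by (rule fork_nn_integral_past[OF law_R lawQ lawQ' h _ _ order_refl that]) (use h01 h1 in auto)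
  have "(\<integral>\<^sup>+\<omega>. g \<omega> * max (?Y \<omega>) (?Y' \<omega>) \<partial>Q) = (\<integral>\<^sup>+\<omega>. g \<omega> * stopped E \<tau>'' \<omega> \<partial>Q'')"
    if g: "g \<in> borel_measurable (F t)" for g
  proof -
    have gB: "(\<lambda>\<omega>. g \<omega> * indicator (- B) \<omega>) \<in> borel_measurable (F t)"
      "(\<lambda>\<omega>. g \<omega> * ennreal (?k \<omega>)) \<in> borel_measurable (F t)"
      "(\<lambda>\<omega>. g \<omega> * indicator B \<omega> * ?Y' \<omega>) \<in> borel_measurable (F t)"
      using g k by auto
    have stopped: "stopped E \<tau>'' \<omega> = (if \<omega> \<in> B then stopped E \<tau>' \<omega> else stopped E \<tau> \<omega>)" for \<omega>
      by (simp add: stopped_def \<tau>''_def)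
    have "stopped E \<tau>'' \<in> borel_measurable Q''" by (rule stopped_measurable_H[OF c'' Q''])
    then have "(\<lambda>\<omega>. g \<omega> * stopped E \<tau>'' \<omega>) \<in> borel_measurable (seq_space M)"
      using seq[OF g] law_H[OF Q''] by (simp add: law_def cong: measurable_cong_sets)
    from int[OF this] have "(\<integral>\<^sup>+\<omega>. g \<omega> * stopped E \<tau>'' \<omega> \<partial>Q'')
      = (\<integral>\<^sup>+\<omega>. ennreal (h \<omega>) * (g \<omega> * stopped E \<tau>'' \<omega>) \<partial>Q) + (\<integral>\<^sup>+\<omega>. ennreal (?k \<omega>) * (g \<omega> * stopped E \<tau>'' \<omega>) \<partial>Q')" .
    also have "(\<integral>\<^sup>+\<omega>. ennreal (h \<omega>) * (g \<omega> * stopped E \<tau>'' \<omega>) \<partial>Q) = (\<integral>\<^sup>+\<omega>. g \<omega> * indicator (- B) \<omega> * stopped E \<tau> \<omega> \<partial>Q)"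
      by (intro nn_integral_cong) (auto simp: h_def stopped indicator_def)
    also have "\<dots> = (\<integral>\<^sup>+\<omega>. g \<omega> * indicator (- B) \<omega> * ?Y \<omega> \<partial>Q)"
      by (rule nn_integral_reward[OF c gB(1), symmetric])
    also have "(\<integral>\<^sup>+\<omega>. ennreal (?k \<omega>) * (g \<omega> * stopped E \<tau>'' \<omega>) \<partial>Q') = (\<integral>\<^sup>+\<omega>. g \<omega> * ennreal (?k \<omega>) * stopped E \<tau>' \<omega> \<partial>Q')"
      by (intro nn_integral_cong) (auto simp: h_def fork_weight_def stopped indicator_def mult_ac)
    also have "\<dots> = (\<integral>\<^sup>+\<omega>. g \<omega> * ennreal (?k \<omega>) * ?Y' \<omega> \<partial>Q')"
      by (rule nn_integral_reward[OF c' gB(2), symmetric])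
    also have "\<dots> = (\<integral>\<^sup>+\<omega>. g \<omega> * ennreal (?k \<omega>) * ?Y' \<omega> * ennreal (Z Q' t \<omega>) \<partial>R)"
      using gB(2) Y' by (intro nn_integral_likelihood_ratio[OF law_R lawQ']) auto
    \<comment> \<open>The weight exchanges the laws on F_t: it satisfies k Z'_t = 1_B Z_t, because
      Z'_t > 0 on B. The reward of Q' is thereby integrated under Q.\<close>
    also have "\<dots> = (\<integral>\<^sup>+\<omega>. g \<omega> * indicator B \<omega> * ?Y' \<omega> * ennreal (Z Q t \<omega>) \<partial>R)"
    proof (intro nn_integral_cong)
      fix \<omega>
      have "ennreal (?k \<omega>) * ennreal (Z Q' t \<omega>) = ennreal (?k \<omega> * Z Q' t \<omega>)"
        using h01[of \<omega>] by (intro ennreal_mult[symmetric]) (auto simp: fork_weight_def)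
      also have "?k \<omega> * Z Q' t \<omega> = indicator B \<omega> * Z Q t \<omega>"
        using h1[of \<omega>] by (auto simp: fork_weight_def h_def indicator_def)
      finally have "ennreal (?k \<omega>) * ennreal (Z Q' t \<omega>) = indicator B \<omega> * ennreal (Z Q t \<omega>)"
        by (auto simp: indicator_def)
      moreover have "g \<omega> * ennreal (?k \<omega>) * ?Y' \<omega> * ennreal (Z Q' t \<omega>)
          = g \<omega> * ?Y' \<omega> * (ennreal (?k \<omega>) * ennreal (Z Q' t \<omega>))" by (simp add: mult_ac)
      ultimately show "g \<omega> * ennreal (?k \<omega>) * ?Y' \<omega> * ennreal (Z Q' t \<omega>) = g \<omega> * indicator B \<omega> * ?Y' \<omega> * ennreal (Z Q t \<omega>)"
        by (simp add: mult_ac)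
    qed
    also have "\<dots> = (\<integral>\<^sup>+\<omega>. g \<omega> * indicator B \<omega> * ?Y' \<omega> \<partial>Q)"
      by (rule nn_integral_likelihood_ratio[OF law_R lawQ gB(3), symmetric])
    also have "(\<integral>\<^sup>+\<omega>. g \<omega> * indicator (- B) \<omega> * ?Y \<omega> \<partial>Q) + (\<integral>\<^sup>+\<omega>. g \<omega> * indicator B \<omega> * ?Y' \<omega> \<partial>Q)
      = (\<integral>\<^sup>+\<omega>. g \<omega> * indicator (- B) \<omega> * ?Y \<omega> + g \<omega> * indicator B \<omega> * ?Y' \<omega> \<partial>Q)"
      using gB Y by (intro nn_integral_add[symmetric] measurable_coord_filt_law[OF lawQ(1), of _ t]) auto
    also have "\<dots> = (\<integral>\<^sup>+\<omega>. g \<omega> * max (?Y \<omega>) (?Y' \<omega>) \<partial>Q)"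
      by (intro nn_integral_cong) (auto simp: B_def indicator_def max_def space_law[OF lawQ(1)])
    finally show ?thesis by simp
  qed
  then show ?thesis using that[OF c'' past] by blast
qed

text \<open>Induction, pasting one more continuation at a time onto the accumulated pair. Agreement
  of the laws on F_t is carried along so that rewards, which are F_t-measurable, can be integrated
  under Q or under the current law alike.\<close>

lemma paste_finite:
  fixes y :: "nat \<Rightarrow> (nat \<Rightarrow> 'a) \<Rightarrow> ennreal"
  assumes Q: "Q \<in> H" and y: "range y \<subseteq> insert (\<lambda>_. 0) (reward t ` continuations t)"
  shows "\<exists>Q' \<tau>. (Q', \<tau>) \<in> continuations t \<and>
    (\<forall>f\<in>borel_measurable (F t). (\<integral>\<^sup>+\<omega>. f \<omega> \<partial>Q') = (\<integral>\<^sup>+\<omega>. f \<omega> \<partial>Q :: ennreal)) \<and>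
    (\<forall>g\<in>borel_measurable (F t). (\<integral>\<^sup>+\<omega>. g \<omega> * (SUP i\<in>{..<n}. y i \<omega>) \<partial>Q) \<le> (\<integral>\<^sup>+\<omega>. g \<omega> * stopped E \<tau> \<omega> \<partial>Q'))"
proof (induction n)
  case 0
  have "(Q, \<lambda>_. enat t) \<in> continuations t"
    using Q by (auto simp: continuations_def seq_stopping_time_const)
  \<comment> \<open>The supremum over the empty set is 0, so stopping at once under Q itself is good
    enough.\<close>
  then show ?case by (intro exI[of _ Q] exI[of _ "\<lambda>_. enat t"]) (auto simp: bot_ennreal)
next
  case (Suc n)
  then obtain Q' \<tau> where c: "(Q', \<tau>) \<in> continuations t"
    and past: "\<And>f. f \<in> borel_measurable (F t) \<Longrightarrow> (\<integral>\<^sup>+\<omega>. f \<omega> \<partial>Q') = (\<integral>\<^sup>+\<omega>. f \<omega> \<partial>Q :: ennreal)"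
    and le: "\<And>g. g \<in> borel_measurable (F t) \<Longrightarrow>
      (\<integral>\<^sup>+\<omega>. g \<omega> * (SUP i\<in>{..<n}. y i \<omega>) \<partial>Q) \<le> (\<integral>\<^sup>+\<omega>. g \<omega> * stopped E \<tau> \<omega> \<partial>Q')" by blast
  let ?m = "\<lambda>\<omega>. SUP i\<in>{..<n}. y i \<omega>"
  have SUP: "(SUP i\<in>{..<Suc n}. y i \<omega>) = max (?m \<omega>) (y n \<omega>)" for \<omega>
    by (simp add: lessThan_Suc sup_max max.commute)
  have yF: "y i \<in> borel_measurable (F t)" for i
  proof -
    have "y i \<in> insert (\<lambda>_. 0) (reward t ` continuations t)" using y by auto
    then show ?thesis using reward_measurable by auto
  qed
  have mF: "?m \<in> borel_measurable (F t)" using yF by simp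
  show ?case
  proof (cases "y n = (\<lambda>_. 0)")
    case True
    then show ?thesis using c past le by (intro exI[of _ Q'] exI[of _ \<tau>]) (simp add: SUP)
  next
    case False
    then have "y n \<in> reward t ` continuations t" using y by auto
    then obtain Q1 \<tau>1 where c1: "(Q1, \<tau>1) \<in> continuations t" and yn: "y n = reward t (Q1, \<tau>1)" by auto
    obtain Q2 \<tau>2 where c2: "(Q2, \<tau>2) \<in> continuations t"
      and past2: "\<And>f. f \<in> borel_measurable (F t) \<Longrightarrow> (\<integral>\<^sup>+\<omega>. f \<omega> \<partial>Q2) = (\<integral>\<^sup>+\<omega>. f \<omega> \<partial>Q')"
      and max2: "\<And>g. g \<in> borel_measurable (F t) \<Longrightarrow>
        (\<integral>\<^sup>+\<omega>. g \<omega> * max (reward t (Q', \<tau>) \<omega>) (y n \<omega>) \<partial>Q') = (\<integral>\<^sup>+\<omega>. g \<omega> * stopped E \<tau>2 \<omega> \<partial>Q2)"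
      using paste_continuations[OF c c1] unfolding yn by blast
    have "(\<integral>\<^sup>+\<omega>. g \<omega> * (SUP i\<in>{..<Suc n}. y i \<omega>) \<partial>Q) \<le> (\<integral>\<^sup>+\<omega>. g \<omega> * stopped E \<tau>2 \<omega> \<partial>Q2)"
      if g: "g \<in> borel_measurable (F t)" for g
    proof -
      let ?Y = "reward t (Q', \<tau>)"
      note Y = reward_measurable[of t "(Q', \<tau>)"]
      \<comment> \<open>The induction hypothesis compares \<open>?m\<close> with the current reward
        only in integrals, not pointwise. The maximum is therefore split first: the hypothesis is
        applied with the test function g times the indicator of the complement of B, and on B the
        maximum is \<open>y n\<close> itself.\<close>
      define B where "B = {\<omega>\<in>space (F t). ?m \<omega> < y n \<omega>}"
      have B: "B \<in> sets (F t)" unfolding B_def using mF yF[of n] by measurable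
      have gB: "(\<lambda>\<omega>. g \<omega> * indicator (- B) \<omega>) \<in> borel_measurable (F t)"
        "(\<lambda>\<omega>. g \<omega> * indicator B \<omega> * y n \<omega>) \<in> borel_measurable (F t)"
        using g B yF[of n] by auto
      have mP: "f \<in> borel_measurable Q" if "f \<in> borel_measurable (F t)" for f :: "_ \<Rightarrow> ennreal"
        by (rule measurable_coord_filt_law[OF law_H[OF Q] that])
      have "(\<integral>\<^sup>+\<omega>. g \<omega> * (SUP i\<in>{..<Suc n}. y i \<omega>) \<partial>Q)
        = (\<integral>\<^sup>+\<omega>. g \<omega> * indicator (- B) \<omega> * ?m \<omega> + g \<omega> * indicator B \<omega> * y n \<omega> \<partial>Q)"
        by (intro nn_integral_cong) (auto simp: SUP B_def indicator_def max_def space_law[OF law_H[OF Q]])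
      also have "\<dots> = (\<integral>\<^sup>+\<omega>. g \<omega> * indicator (- B) \<omega> * ?m \<omega> \<partial>Q) + (\<integral>\<^sup>+\<omega>. g \<omega> * indicator B \<omega> * y n \<omega> \<partial>Q)"
        using gB mF by (intro nn_integral_add mP) auto
      also have "\<dots> \<le> (\<integral>\<^sup>+\<omega>. g \<omega> * indicator (- B) \<omega> * ?Y \<omega> \<partial>Q) + (\<integral>\<^sup>+\<omega>. g \<omega> * indicator B \<omega> * y n \<omega> \<partial>Q)"
      proof (rule add_right_mono)
        have "(\<integral>\<^sup>+\<omega>. g \<omega> * indicator (- B) \<omega> * ?m \<omega> \<partial>Q) \<le> (\<integral>\<^sup>+\<omega>. g \<omega> * indicator (- B) \<omega> * ?Y \<omega> \<partial>Q')"
          using le[OF gB(1)] nn_integral_reward[OF c gB(1)] by simp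
        also have "\<dots> = (\<integral>\<^sup>+\<omega>. g \<omega> * indicator (- B) \<omega> * ?Y \<omega> \<partial>Q)"
          using gB(1) Y by (intro past) auto
        finally show "(\<integral>\<^sup>+\<omega>. g \<omega> * indicator (- B) \<omega> * ?m \<omega> \<partial>Q) \<le> (\<integral>\<^sup>+\<omega>. g \<omega> * indicator (- B) \<omega> * ?Y \<omega> \<partial>Q)" .
      qed
      also have "\<dots> = (\<integral>\<^sup>+\<omega>. g \<omega> * indicator (- B) \<omega> * ?Y \<omega> + g \<omega> * indicator B \<omega> * y n \<omega> \<partial>Q)"
        using gB Y by (intro nn_integral_add[symmetric] mP) auto
      also have "\<dots> \<le> (\<integral>\<^sup>+\<omega>. g \<omega> * max (?Y \<omega>) (y n \<omega>) \<partial>Q)"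
        by (intro nn_integral_mono) (auto simp: indicator_def intro!: mult_left_mono)
      also have "\<dots> = (\<integral>\<^sup>+\<omega>. g \<omega> * max (?Y \<omega>) (y n \<omega>) \<partial>Q')"
        using g Y yF[of n] by (intro past[symmetric]) auto
      also have "\<dots> = (\<integral>\<^sup>+\<omega>. g \<omega> * stopped E \<tau>2 \<omega> \<partial>Q2)" by (rule max2[OF g])
      finally show ?thesis .
    qed
    then show ?thesis using c2 past past2 by (intro exI[of _ Q2] exI[of _ \<tau>2]) auto
  qed
qed

text \<open>The supermartingale property is one direction of dynamic programming: whatever is
  achievable in the limit from t on, after an arbitrary past under Q, is realised by laws that agree
  with Q on F_t, and these compete already at the earlier time s. The last clause bounds the initial
  value by the best expected payoff.\<close>

lemma Snell_envelope:
  obtains L :: "nat \<Rightarrow> (nat \<Rightarrow> 'a) \<Rightarrow> ennreal" where "\<And>t. L t \<in> borel_measurable (F t)"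
    "\<And>Q. Q \<in> H \<Longrightarrow> nn_supermartingale M Q L"
    "\<And>t Q. Q \<in> H \<Longrightarrow> AE \<omega> in Q. ennreal (E t \<omega>) \<le> L t \<omega>"
    "\<And>c \<omega>. \<omega> \<in> space (seq_space M) \<Longrightarrow>
      (\<And>Q \<tau>. Q \<in> H \<Longrightarrow> seq_stopping_time M \<tau> \<Longrightarrow> (\<integral>\<^sup>+\<omega>. stopped E \<tau> \<omega> \<partial>Q) \<le> c) \<Longrightarrow> L 0 \<omega> \<le> c"
proof -
  define maj where "maj t y \<longleftrightarrow> range y \<subseteq> insert (\<lambda>_. 0) (reward t ` continuations t) \<and>
      (\<forall>c\<in>continuations t. AE \<omega> in R. reward t c \<omega> \<le> (SUP i. y i \<omega>))"
    for t and y :: "nat \<Rightarrow> (nat \<Rightarrow> 'a) \<Rightarrow> ennreal"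
  have "\<exists>y. maj t y" for t
  proof -
    have "finite_measure R" using law_R by (simp add: law_def prob_space.finite_measure)
    moreover have "reward t ` continuations t \<subseteq> borel_measurable R"
      using measurable_coord_filt_law[OF law_R reward_measurable] by auto
    ultimately obtain y :: "nat \<Rightarrow> (nat \<Rightarrow> 'a) \<Rightarrow> ennreal"
      where y: "range y \<subseteq> insert (\<lambda>_. 0) (reward t ` continuations t)"
      and ub: "\<And>f. f \<in> reward t ` continuations t \<Longrightarrow> AE x in R. f x \<le> (SUP i. y i x)"
      using countable_essential_supremum by blast
    have "maj t y" unfolding maj_def by (intro conjI ballI y ub imageI)
    then show ?thesis by (intro exI[of _ y])
  qed
  then have "\<forall>t. \<exists>y. maj t y" by (rule allI)
  from choice[OF this] obtain y where maj: "\<And>t. maj t (y t)" by blast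
  have y: "range (y t) \<subseteq> insert (\<lambda>_. 0) (reward t ` continuations t)" for t
    using maj[of t] unfolding maj_def by (rule conjunct1)
  have ub: "AE \<omega> in R. reward t c \<omega> \<le> (SUP i. y t i \<omega>)" if "c \<in> continuations t" for t c
    using maj[of t, unfolded maj_def, THEN conjunct2] that by (rule bspec)
  have y': "y t i \<in> insert (\<lambda>_. 0) (reward t ` continuations t)" for t i using y[of t] by auto
  have yF: "y t i \<in> borel_measurable (F t)" for t i
    using y'[of t i] reward_measurable by auto
  define L where "L t \<omega> = (SUP i. y t i \<omega>)" for t \<omega>
  have LF: "L t \<in> borel_measurable (F t)" for t unfolding L_def[abs_def] using yF by simp
  have ubQ: "AE \<omega> in Q. reward t c \<omega> \<le> L t \<omega>" if "Q \<in> H" "c \<in> continuations t" for t c Q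
  proof (rule AE_locally_dominated[OF law_R law_H dominated_H])
    show "Measurable.pred (F t) (\<lambda>\<omega>. reward t c \<omega> \<le> L t \<omega>)"
      unfolding pred_def by (rule borel_measurable_le[OF reward_measurable LF])
    show "AE \<omega> in R. reward t c \<omega> \<le> L t \<omega>" using ub[OF that(2)] by (simp add: L_def)
  qed fact+
  show ?thesis
  proof (rule that[of L])
    show "nn_supermartingale M Q L" if Q: "Q \<in> H" for Q
      unfolding nn_supermartingale_def
    proof (intro allI impI)
      fix s t and g :: "(nat \<Rightarrow> 'a) \<Rightarrow> ennreal"
      assume st: "s \<le> t" and g: "g \<in> borel_measurable (F s)"
      have gt: "g \<in> borel_measurable (F t)" by (rule measurable_coord_filt_mono[OF st g])
      have gQ: "g \<in> borel_measurable Q" "y t i \<in> borel_measurable Q" for i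
        by (rule measurable_coord_filt_law[OF law_H[OF Q] gt], rule measurable_coord_filt_law[OF law_H[OF Q] yF])
      let ?m = "\<lambda>n \<omega>. SUP i\<in>{..<n}. y t i \<omega>"
      have "(\<integral>\<^sup>+\<omega>. g \<omega> * L t \<omega> \<partial>Q) = (\<integral>\<^sup>+\<omega>. (SUP n. g \<omega> * ?m n \<omega>) \<partial>Q)"
      proof (intro nn_integral_cong)
        fix \<omega>
        have "L t \<omega> = (SUP n. ?m n \<omega>)"
          unfolding L_def
        proof (rule antisym)
          show "(SUP i. y t i \<omega>) \<le> (SUP n. ?m n \<omega>)"
          proof (rule SUP_least)
            fix i
            have "y t i \<omega> \<le> ?m (Suc i) \<omega>" by (rule SUP_upper) simp
            also have "\<dots> \<le> (SUP n. ?m n \<omega>)" by (rule SUP_upper) simp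
            finally show "y t i \<omega> \<le> (SUP n. ?m n \<omega>)" .
          qed
        qed (auto intro!: SUP_least SUP_upper)
        then show "g \<omega> * L t \<omega> = (SUP n. g \<omega> * ?m n \<omega>)" by (simp add: SUP_mult_left_ennreal)
      qed
      also have "\<dots> = (SUP n. \<integral>\<^sup>+\<omega>. g \<omega> * ?m n \<omega> \<partial>Q)"
      proof (rule nn_integral_monotone_convergence_SUP)
        show "incseq (\<lambda>n \<omega>. g \<omega> * ?m n \<omega>)"
          by (auto simp: incseq_def le_fun_def intro!: mult_left_mono SUP_subset_mono)
        show "(\<lambda>\<omega>. g \<omega> * ?m n \<omega>) \<in> borel_measurable Q" for n
          using gQ by (intro borel_measurable_times_ennreal borel_measurable_SUP) auto
      qed
      also have "\<dots> \<le> (\<integral>\<^sup>+\<omega>. g \<omega> * L s \<omega> \<partial>Q)"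
      proof (rule SUP_least)
        fix n
        obtain Q' \<tau> where c: "(Q', \<tau>) \<in> continuations t"
          and past: "\<And>f. f \<in> borel_measurable (F t) \<Longrightarrow> (\<integral>\<^sup>+\<omega>. f \<omega> \<partial>Q') = (\<integral>\<^sup>+\<omega>. f \<omega> \<partial>Q :: ennreal)"
          and le: "(\<integral>\<^sup>+\<omega>. g \<omega> * ?m n \<omega> \<partial>Q) \<le> (\<integral>\<^sup>+\<omega>. g \<omega> * stopped E \<tau> \<omega> \<partial>Q')"
          using paste_finite[OF Q y, of t n] gt by blast
        have Q': "Q' \<in> H" using c by (simp add: continuations_def)
        \<comment> \<open>A stopping time that waits until t also waits until s, so the pasted pair
          is among those dominated by L_s.\<close>
        have cs: "(Q', \<tau>) \<in> continuations s"
          using c st by (auto simp: continuations_def intro: order_trans[rotated])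
        note le
        also have "(\<integral>\<^sup>+\<omega>. g \<omega> * stopped E \<tau> \<omega> \<partial>Q') = (\<integral>\<^sup>+\<omega>. g \<omega> * reward s (Q', \<tau>) \<omega> \<partial>Q')"
          by (rule nn_integral_reward[OF cs g, symmetric])
        also have "\<dots> \<le> (\<integral>\<^sup>+\<omega>. g \<omega> * L s \<omega> \<partial>Q')"
          using ubQ[OF Q' cs] by (intro nn_integral_mono_AE) (auto elim!: eventually_mono intro: mult_left_mono)
        also have "\<dots> = (\<integral>\<^sup>+\<omega>. g \<omega> * L s \<omega> \<partial>Q)"
          using gt measurable_coord_filt_mono[OF st LF] by (intro past) auto
        finally show "(\<integral>\<^sup>+\<omega>. g \<omega> * ?m n \<omega> \<partial>Q) \<le> (\<integral>\<^sup>+\<omega>. g \<omega> * L s \<omega> \<partial>Q)" .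
      qed
      finally show "(\<integral>\<^sup>+\<omega>. g \<omega> * L t \<omega> \<partial>Q) \<le> (\<integral>\<^sup>+\<omega>. g \<omega> * L s \<omega> \<partial>Q)" .
    qed
    show "AE \<omega> in Q. ennreal (E t \<omega>) \<le> L t \<omega>" if Q: "Q \<in> H" for t Q
    proof -
      interpret sigma_finite_subalgebra Q "F t" by (rule sigma_finite_subalgebra_law[OF law_H[OF Q]])
      \<comment> \<open>Stopping at once has reward E_t wherever Z_t > 0, hence almost surely under
        Q.\<close>
      have c: "(Q, \<lambda>_. enat t) \<in> continuations t"
        using Q by (auto simp: continuations_def seq_stopping_time_const)
      have "stopped E (\<lambda>_. enat t) \<in> borel_measurable (F t)"
        using adapted unfolding stopped_def[abs_def] enat.case nonneg_adapted_def
        by (intro measurable_compose[OF _ measurable_ennreal]) blast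
      from nn_cond_exp_F_meas[OF this] ubQ[OF Q c] AE_likelihood_ratio_pos[OF law_R law_H[OF Q] dominated_H[OF Q], of t]
      show ?thesis
        by eventually_elim (simp add: reward_def stopped_def)
    qed
    show "L 0 \<omega> \<le> c" if \<omega>: "\<omega> \<in> space (seq_space M)"
      and safe: "\<And>Q \<tau>. Q \<in> H \<Longrightarrow> seq_stopping_time M \<tau> \<Longrightarrow> (\<integral>\<^sup>+\<omega>. stopped E \<tau> \<omega> \<partial>Q) \<le> c" for c \<omega>
      unfolding L_def
    proof (rule SUP_least)
      fix i
      consider "y 0 i = (\<lambda>_. 0)" | Q \<tau> where "(Q, \<tau>) \<in> continuations 0" "y 0 i = reward 0 (Q, \<tau>)"
        using y'[of 0 i] by auto
      then show "y 0 i \<omega> \<le> c"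
      proof cases
        case 2
        have Q: "Q \<in> H" and \<tau>: "seq_stopping_time M \<tau>" using 2(1) by (auto simp: continuations_def)
        interpret prob_space Q using law_H[OF Q] by (simp add: law_def)
        \<comment> \<open>A reward at time 0 is constant and so equals its own expectation, the
          payoff of a stopping time under a law in H.\<close>
        have "y 0 i \<omega> = (\<integral>\<^sup>+_. y 0 i \<omega> \<partial>Q)" by (simp add: emeasure_space_1)
        also have "\<dots> = (\<integral>\<^sup>+\<omega>. y 0 i \<omega> \<partial>Q)"
          using coord_filt_0_const[OF yF \<omega>] by (intro nn_integral_cong) (simp add: space_law[OF law_H[OF Q]])
        also have "\<dots> = (\<integral>\<^sup>+\<omega>. stopped E \<tau> \<omega> \<partial>Q)"
          using nn_integral_reward[OF 2(1), of "\<lambda>_. 1"] by (simp add: 2(2))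
        also have "\<dots> \<le> c" by (rule safe[OF Q \<tau>])
        finally show ?thesis .
      qed simp
    qed
  qed (rule LF)
qed

end

section \<open>Safety on the closed fork-convex hull\<close>

lemma safe_iff:
  "safe M \<P> E \<longleftrightarrow> nonneg_adapted M E \<and>
     (\<forall>P\<in>\<P>. \<forall>\<tau>. seq_stopping_time M \<tau> \<longrightarrow> (\<integral>\<^sup>+\<omega>. stopped E \<tau> \<omega> \<partial>P) \<le> 1)"
  by (auto simp: safe_def SUP_le_iff)

lemma dominated_imp_safe_closed_fork_hull:
  assumes R: "law M R" and Q: "\<And>Q. Q \<in> \<Q> \<Longrightarrow> law M Q \<and> locally_dominated M R Q"
    and E: "nonneg_adapted M E" and L: "NSM M \<Q> L"
    and L0: "\<And>\<omega>. \<omega> \<in> space (seq_space M) \<Longrightarrow> L 0 \<omega> \<le> 1" and dom: "dominated_by \<Q> E L"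
  shows "safe M (closed_fork_hull M R \<Q>) E"
  unfolding safe_iff
proof (intro conjI ballI allI impI E)
  fix P \<tau> assume P: "P \<in> closed_fork_hull M R \<Q>" and \<tau>: "seq_stopping_time M \<tau>"
  have lawP: "law M P" using P by (simp add: closed_fork_hull_def)
  interpret prob_space P using lawP by (simp add: law_def)
  have nnL: "nonneg_adapted M L" using L by (simp add: NSM_def)
  have "nn_supermartingale M Q (\<lambda>t \<omega>. ennreal (L t \<omega>))" if "Q \<in> \<Q>" for Q
    using L that Q by (intro nn_supermartingale_supermartingale nnL) (auto simp: NSM_def)
  from closed_fork_hull_nn_supermartingale[OF R Q nnL this P]
  have sm: "nn_supermartingale M P (\<lambda>t \<omega>. ennreal (L t \<omega>))" .
  have "AE \<omega> in P. E t \<omega> \<le> L t \<omega>" for t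
  proof -
    \<comment> \<open>The exceptional event lies in F_t, which is what allows its nullity to pass to
      the closed hull.\<close>
    define A where "A = {\<omega>\<in>space (coord_filt M t). L t \<omega> < E t \<omega>}"
    have A: "A \<in> sets (coord_filt M t)"
      unfolding A_def using E nnL by (intro borel_measurable_less) (auto simp: nonneg_adapted_def)
    have "emeasure Q A = 0" if "Q \<in> \<Q>" for Q
    proof -
      have "AE \<omega> in Q. E t \<omega> \<le> L t \<omega>"
        using dom that unfolding dominated_by_def by blast
      then have "AE \<omega> in Q. \<omega> \<notin> A" by eventually_elim (simp add: A_def)
      moreover have "A \<in> sets Q" using Q[OF that] sets_coord_filt_law[OF _ A] by blast
      ultimately have "A \<in> null_sets Q" by (simp only: AE_iff_null_sets)
      then show ?thesis by (rule null_setsD1)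
    qed
    from closed_fork_hull_null[OF R Q A this P] have "A \<in> null_sets P"
      using sets_coord_filt_law[OF lawP A] by (simp add: null_sets_def)
    from AE_not_in[OF this] AE_space show ?thesis
      by eventually_elim (auto simp: A_def space_law[OF lawP])
  qed
  \<comment> \<open>Domination at all times simultaneously is needed to compare the limits superior
    where \<tau> is infinite.\<close>
  then have "AE \<omega> in P. \<forall>t. E t \<omega> \<le> L t \<omega>" by (simp add: AE_all_countable)
  then have "AE \<omega> in P. stopped E \<tau> \<omega> \<le> stopped L \<tau> \<omega>"
    by eventually_elim (auto simp: stopped_def intro!: ennreal_leI Limsup_mono always_eventually split: enat.splits)
  then have "(\<integral>\<^sup>+\<omega>. stopped E \<tau> \<omega> \<partial>P) \<le> (\<integral>\<^sup>+\<omega>. stopped L \<tau> \<omega> \<partial>P)"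
    by (rule nn_integral_mono_AE)
  also have "\<dots> \<le> (\<integral>\<^sup>+\<omega>. ennreal (L 0 \<omega>) \<partial>P)"
    by (rule nn_supermartingale_stopped[OF lawP \<tau> nnL sm])
  also have "\<dots> \<le> (\<integral>\<^sup>+\<omega>. 1 \<partial>P)"
    using L0 by (intro nn_integral_mono) (simp add: space_law[OF lawP])
  also have "\<dots> = 1" by (simp add: emeasure_space_1)
  finally show "(\<integral>\<^sup>+\<omega>. stopped E \<tau> \<omega> \<partial>P) \<le> 1" .
qed

text \<open>The envelope is taken over the hull, which lies inside the closed hull; safety there
  bounds its initial value by 1. It remains to replace an extended-real process by a real
  one.\<close>

lemma safe_closed_fork_hull_imp_dominated:
  assumes R: "law M R" and Q: "\<And>Q. Q \<in> \<Q> \<Longrightarrow> law M Q \<and> locally_dominated M R Q"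
    and safe: "safe M (closed_fork_hull M R \<Q>) E"
  obtains L where "NSM M \<Q> L" "\<And>\<omega>. \<omega> \<in> space (seq_space M) \<Longrightarrow> L 0 \<omega> \<le> 1" "dominated_by \<Q> E L"
proof -
  have E: "nonneg_adapted M E" using safe by (simp add: safe_iff)
  interpret fork_convex_family M R "fork_hull M R \<Q>" E
    by unfold_locales (use R E fork_convex_fork_hull[OF Q] in auto)
  obtain L where L: "\<And>t. L t \<in> borel_measurable (coord_filt M t)"
    and sm: "\<And>Q. Q \<in> fork_hull M R \<Q> \<Longrightarrow> nn_supermartingale M Q L"
    and dom: "\<And>t Q. Q \<in> fork_hull M R \<Q> \<Longrightarrow> AE \<omega> in Q. ennreal (E t \<omega>) \<le> L t \<omega>"
    and L0': "\<And>c \<omega>. \<omega> \<in> space (seq_space M) \<Longrightarrow>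
      (\<And>Q \<tau>. Q \<in> fork_hull M R \<Q> \<Longrightarrow> seq_stopping_time M \<tau> \<Longrightarrow> (\<integral>\<^sup>+\<omega>. stopped E \<tau> \<omega> \<partial>Q) \<le> c) \<Longrightarrow> L 0 \<omega> \<le> c"
    using Snell_envelope by blast
  have L0: "L 0 \<omega> \<le> 1" if "\<omega> \<in> space (seq_space M)" for \<omega>
    using safe fork_hull_subset_closed[OF Q] by (intro L0'[OF that]) (auto simp: safe_iff)
  \<comment> \<open>\<open>enn2real\<close> sends \<infinity> to 0, which could destroy domination;
    but the expectation of L_t under each law in \<Q> is at most 1, so L_t is finite almost
    surely.\<close>
  define L' where "L' t \<omega> = enn2real (L t \<omega>)" for t \<omega>
  have adapted: "nonneg_adapted M L'"
    unfolding nonneg_adapted_def L'_def[abs_def] using L by (auto intro: borel_measurable_enn2real)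
  have L'0: "L' 0 \<omega> \<le> 1" if "\<omega> \<in> space (seq_space M)" for \<omega>
    using enn2real_mono[OF L0[OF that]] by (simp add: L'_def)
  have main: "supermartingale M Q L' \<and> (\<forall>t. AE \<omega> in Q. E t \<omega> \<le> L' t \<omega>)" if "Q \<in> \<Q>" for Q
  proof -
    have QH: "Q \<in> fork_hull M R \<Q>" using subset_fork_hull that by blast
    have lawQ: "law M Q" using Q[OF that] by simp
    interpret prob_space Q using lawQ by (simp add: law_def)
    have fin: "(\<integral>\<^sup>+\<omega>. L t \<omega> \<partial>Q) \<le> 1" for t
    proof -
      have "(\<integral>\<^sup>+\<omega>. L t \<omega> \<partial>Q) \<le> (\<integral>\<^sup>+\<omega>. L 0 \<omega> \<partial>Q)"
        using nn_supermartingaleD[OF sm[OF QH], of 0 t "\<lambda>_. 1"] by simp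
      also have "\<dots> \<le> (\<integral>\<^sup>+\<omega>. 1 \<partial>Q)" using L0 by (intro nn_integral_mono) (simp add: space_law[OF lawQ])
      finally show ?thesis by (simp add: emeasure_space_1)
    qed
    have eq: "AE \<omega> in Q. ennreal (L' t \<omega>) = L t \<omega>" for t
    proof -
      have "AE \<omega> in Q. L t \<omega> \<noteq> \<infinity>"
        using fin[of t] by (intro nn_integral_noteq_infinite measurable_coord_filt_law[OF lawQ L]) (auto simp: top_unique)
      then show ?thesis by eventually_elim (simp add: L'_def less_top)
    qed
    have eq': "(\<integral>\<^sup>+\<omega>. g \<omega> * ennreal (L' t \<omega>) \<partial>Q) = (\<integral>\<^sup>+\<omega>. g \<omega> * L t \<omega> \<partial>Q)" for t g
      using eq[of t] by (intro nn_integral_cong_AE) (auto elim!: eventually_mono)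
    have "nn_supermartingale M Q (\<lambda>t \<omega>. ennreal (L' t \<omega>))"
      using sm[OF QH] by (simp add: nn_supermartingale_def eq')
    moreover have "(\<integral>\<^sup>+\<omega>. ennreal (L' 0 \<omega>) \<partial>Q) < \<infinity>"
      using fin[of 0] eq'[of "\<lambda>_. 1" 0] by (auto simp: le_less_trans)
    ultimately have "supermartingale M Q L'"
      by (rule supermartingale_nn_supermartingale[OF lawQ adapted])
    moreover have "AE \<omega> in Q. E t \<omega> \<le> L' t \<omega>" for t
      using dom[OF QH, of t] eq[of t]
    proof eventually_elim
      case (elim \<omega>)
      then have "ennreal (E t \<omega>) \<le> ennreal (L' t \<omega>)" by simp
      moreover have "0 \<le> L' t \<omega>" by (simp add: L'_def)
      ultimately show ?case by (simp only: ennreal_le_iff)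
    qed
    ultimately show ?thesis by blast
  qed
  show ?thesis
    by (rule that[of L']) (use main adapted L'0 in \<open>auto simp: NSM_def dominated_by_def\<close>)
qed

section \<open>Crossing probabilities of safe processes\<close>

lemma first_exceed_attained:
  assumes "first_exceed E c \<omega> < \<infinity>"
  obtains n where "first_exceed E c \<omega> = enat n" "1 \<le> n" "c \<le> E n \<omega>"
proof -
  let ?A = "enat ` {t. 1 \<le> t \<and> c \<le> E t \<omega>}"
  have eq: "first_exceed E c \<omega> = (if ?A = {} then \<infinity> else (LEAST x. x \<in> ?A))"
    unfolding first_exceed_def by (simp only: Inf_enat_def)
  with assms have "?A \<noteq> {}" by (auto split: if_splits)
  then have "first_exceed E c \<omega> \<in> ?A" unfolding eq by (auto intro: LeastI)
  then show ?thesis using that by auto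
qed

lemma first_exceed_le_iff: "first_exceed E c \<omega> \<le> enat n \<longleftrightarrow> (\<exists>t\<in>{1..n}. c \<le> E t \<omega>)"
proof
  assume le: "first_exceed E c \<omega> \<le> enat n"
  then have "first_exceed E c \<omega> < \<infinity>" using le_less_trans enat_ord_simps(4) by blast
  then show "\<exists>t\<in>{1..n}. c \<le> E t \<omega>"
    using le by (elim first_exceed_attained) auto
next
  assume "\<exists>t\<in>{1..n}. c \<le> E t \<omega>"
  then obtain t where "1 \<le> t" "t \<le> n" "c \<le> E t \<omega>" by auto
  then show "first_exceed E c \<omega> \<le> enat n"
    unfolding first_exceed_def by (intro INF_lower2[of t]) auto
qed

lemma seq_stopping_time_first_exceed:
  assumes E: "nonneg_adapted M E"
  shows "seq_stopping_time M (first_exceed E c)"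
  unfolding seq_stopping_time_def
proof (rule stopping_timeI)
  fix u :: enat
  show "Measurable.pred (case u of enat n \<Rightarrow> coord_filt M n | \<infinity> \<Rightarrow> seq_space M)
      (\<lambda>\<omega>. first_exceed E c \<omega> \<le> u)"
  proof (cases u)
    case (enat n)
    have "{\<omega>\<in>space (coord_filt M n). c \<le> E t \<omega>} \<in> sets (coord_filt M n)" if "t \<in> {1..n}" for t
    proof -
      have "E t \<in> borel_measurable (coord_filt M n)"
        by (rule measurable_coord_filt_mono[of t]) (use that E in \<open>auto simp: nonneg_adapted_def\<close>)
      then show ?thesis by (intro borel_measurable_le) auto
    qed
    then have "(\<Union>t\<in>{1..n}. {\<omega>\<in>space (coord_filt M n). c \<le> E t \<omega>}) \<in> sets (coord_filt M n)"
      by (intro sets.finite_UN) auto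
    also have "(\<Union>t\<in>{1..n}. {\<omega>\<in>space (coord_filt M n). c \<le> E t \<omega>})
      = {\<omega>\<in>space (coord_filt M n). first_exceed E c \<omega> \<le> enat n}" by (auto simp: first_exceed_le_iff)
    finally show ?thesis by (simp only: enat pred_def enat.case)
  qed simp
qed

text \<open>Markov's inequality at the first crossing time: where it is finite, the stopped value is
  at least 1 / \<alpha>, while safety bounds its expectation by 1. Elsewhere the limit superior is
  merely nonnegative.\<close>

lemma safe_imp_powerless:
  assumes laws: "\<And>P. P \<in> \<P> \<Longrightarrow> law M P" and safe: "safe M \<P> E"
  shows "powerless \<P> E"
  unfolding powerless_def
proof (intro ballI)
  fix P and \<alpha> :: real assume P: "P \<in> \<P>" and \<alpha>: "\<alpha> \<in> {0<..<1}"
  note lawP = laws[OF P]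
  interpret prob_space P using lawP by (simp add: law_def)
  let ?\<tau> = "first_exceed E (1 / \<alpha>)"
  let ?A = "{\<omega>\<in>space P. ?\<tau> \<omega> < \<infinity>}"
  have E: "nonneg_adapted M E" using safe by (simp add: safe_iff)
  note \<tau> = seq_stopping_time_first_exceed[OF E, of "1 / \<alpha>"]
  have "?A = (\<Union>n. {\<omega>\<in>space (coord_filt M n). ?\<tau> \<omega> \<le> enat n})"
  proof (intro set_eqI iffI)
    fix \<omega> assume \<omega>: "\<omega> \<in> ?A"
    then have "?\<tau> \<omega> < \<infinity>" by simp
    then obtain n where "?\<tau> \<omega> = enat n" by (rule less_infinityE)
    with \<omega> show "\<omega> \<in> (\<Union>n. {\<omega>\<in>space (coord_filt M n). ?\<tau> \<omega> \<le> enat n})"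
      by (auto simp: space_law[OF lawP])
  next
    fix \<omega> assume "\<omega> \<in> (\<Union>n. {\<omega>\<in>space (coord_filt M n). ?\<tau> \<omega> \<le> enat n})"
    then obtain n where "\<omega> \<in> space P" "?\<tau> \<omega> \<le> enat n" by (auto simp: space_law[OF lawP])
    moreover have "enat n < \<infinity>" by simp
    ultimately show "\<omega> \<in> ?A" using le_less_trans by blast
  qed
  also have "\<dots> \<in> sets P"
  proof (intro sets.countable_UN image_subsetI)
    fix n
    show "{\<omega>\<in>space (coord_filt M n). ?\<tau> \<omega> \<le> enat n} \<in> sets P"
      by (rule sets_coord_filt_law[OF lawP]) (rule seq_stopping_time_pred[OF \<tau>, unfolded pred_def])
  qed
  finally have A: "?A \<in> sets P" .
  have "ennreal (1 / \<alpha>) * emeasure P ?A = (\<integral>\<^sup>+\<omega>. ennreal (1 / \<alpha>) * indicator ?A \<omega> \<partial>P)"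
    by (rule nn_integral_cmult_indicator[OF A, symmetric])
  also have "\<dots> \<le> (\<integral>\<^sup>+\<omega>. stopped E ?\<tau> \<omega> \<partial>P)"
  proof (rule nn_integral_mono)
    fix \<omega>
    show "ennreal (1 / \<alpha>) * indicator ?A \<omega> \<le> stopped E ?\<tau> \<omega>"
    proof (cases "\<omega> \<in> ?A")
      case True
      then have "?\<tau> \<omega> < \<infinity>" by simp
      then obtain n where "?\<tau> \<omega> = enat n" "1 / \<alpha> \<le> E n \<omega>" by (rule first_exceed_attained)
      then show ?thesis using True by (simp add: stopped_def ennreal_leI)
    qed simp
  qed
  also have "\<dots> \<le> 1" using safe P \<tau> by (auto simp: safe_iff)
  finally have "ennreal (1 / \<alpha>) * emeasure P ?A \<le> ennreal 1" by (simp only: ennreal_1)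
  moreover have "ennreal (1 / \<alpha> * measure P ?A) = ennreal (1 / \<alpha>) * emeasure P ?A"
    unfolding emeasure_eq_measure using \<alpha> by (intro ennreal_mult) auto
  ultimately have "ennreal (1 / \<alpha> * measure P ?A) \<le> ennreal 1" by (simp only:)
  then have "1 / \<alpha> * measure P ?A \<le> 1" by (subst (asm) ennreal_le_iff) auto
  then show "measure P ?A \<le> \<alpha>" using \<alpha> by (simp add: field_simps)
qed

theorem corollary16:
  fixes M :: "'a measure"
    and R :: "(nat \<Rightarrow> 'a) measure"
    and \<Q> :: "(nat \<Rightarrow> 'a) measure set"
    and E :: "nat \<Rightarrow> (nat \<Rightarrow> 'a) \<Rightarrow> real"
  assumes "law M R"
    and "\<And>Q. Q \<in> \<Q> \<Longrightarrow> law M Q"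
    and "\<And>Q. Q \<in> \<Q> \<Longrightarrow> locally_dominated M R Q"
    and "safe M \<Q> E"
  shows "((\<exists>L. NSM M \<Q> L \<and> (\<forall>\<omega>\<in>space (seq_space M). L 0 \<omega> \<le> 1) \<and> dominated_by \<Q> E L)
            \<longleftrightarrow> safe M (closed_fork_hull M R \<Q>) E)
       \<and> (safe M (closed_fork_hull M R \<Q>) E \<longrightarrow> powerless (closed_fork_hull M R \<Q> - \<Q>) E)"
proof (intro conjI iffI impI)
  have Q: "law M Q \<and> locally_dominated M R Q" if "Q \<in> \<Q>" for Q
    using assms(2,3) that by blast
  have E: "nonneg_adapted M E" using assms(4) by (simp add: safe_iff)
  {
    assume "\<exists>L. NSM M \<Q> L \<and> (\<forall>\<omega>\<in>space (seq_space M). L 0 \<omega> \<le> 1) \<and> dominated_by \<Q> E L"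
    then show "safe M (closed_fork_hull M R \<Q>) E"
      using dominated_imp_safe_closed_fork_hull[OF assms(1) Q E] by blast
  }
  assume safe: "safe M (closed_fork_hull M R \<Q>) E"
  show "\<exists>L. NSM M \<Q> L \<and> (\<forall>\<omega>\<in>space (seq_space M). L 0 \<omega> \<le> 1) \<and> dominated_by \<Q> E L"
    by (rule safe_closed_fork_hull_imp_dominated[OF assms(1) Q safe]) blast+
  show "powerless (closed_fork_hull M R \<Q> - \<Q>) E"
  proof (rule safe_imp_powerless)
    show "law M P" if "P \<in> closed_fork_hull M R \<Q> - \<Q>" for P
      using that by (simp add: closed_fork_hull_def)
    show "safe M (closed_fork_hull M R \<Q> - \<Q>) E"
      using safe unfolding safe_iff by blast
  qed
qed

end
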